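(* Let $\Omega\subset\mathbb{R}^N$ be a bounded domain with sufficiently smooth boundary $\partial\Omega$, let $b>0$, and let $f:\mathbb{R}\to\mathbb{R}$ be a continuous function with $F(s):=\int_0^s f(\tau)\,d\tau$ such that, for some $\alpha>0$ and $r_0\ge 0$, $$f(s)s-2(1+2\alpha)F(s)\ \ge\ -r_0\qquad\text{for all } s\in\mathbb{R}.$$ Consider the initial boundary value problem $$u_{tt}-\Delta u+bu=0,\quad x\in\Omega,\ t>0,$$ $$u(x,0)=u_0(x),\quad u_t(x,0)=u_1(x),\quad x\in\Omega,$$ $$\frac{\partial u}{\partial n}=f(u),\quad x\in\partial\Omega,\ t>0,$$ where $n$ is the outward normal to $\partial\Omega$. Set $R_0=|\partial\Omega|\,r_0$ and $$E_0=\frac12\|u_1\|^2_{L^2(\Omega)}+\frac12\|\nabla u_0\|^2_{L^2(\Omega)}+\frac b2\|u_0\|^2_{L^2(\Omega)}-\int_{\partial\Omega}F(u_0(x))\,d\sigma .$$ Suppose that $u_0\neq 0$, $(u_0,u_1)_{L^2(\Omega)}>0$ and $$\frac{(u_0,u_1)^2_{L^2(\Omega)}}{\|u_0\|^2_{L^2(\Omega)}}\ >\ 2E_0+\frac{R_0}{1+2\alpha}\ >\ 0 .$$ Then the interval of existence $[0,T)$ of the solution $u$ of this problem is finite, i.e. $T<\infty$, and moreover $$\|u(t)\|^2_{L^2(\Omega)}\to+\infty\qquad\text{as } t\to T^- .$$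
   Context: $[0,T)$ denotes the maximal interval of existence of the (local, strong) solution $u$; local solvability is presupposed. The solution satisfies the energy equality $$\frac12\|u_t(t)\|^2_{L^2(\Omega)}+\frac12\|\nabla u(t)\|^2_{L^2(\Omega)}+\frac b2\|u(t)\|^2_{L^2(\Omega)}-\int_{\partial\Omega}F(u(x,t))\,d\sigma=E_0$$ for all $t\in[0,T)$. Here $d\sigma$ is surface measure on $\partial\Omega$ and $|\partial\Omega|$ is the total surface measure of $\partial\Omega$.
   Formalization: The formal theorem adds the assumption that if T is finite and the L² norm of u stays bounded on [0,T), the solution can be continued past T; without it the limit claim fails, e.g. on an interval with f(s)=|s|^{p-1}s, p>3. T<∞ does not depend on it. *)

theory Defs
  imports "HOL-Analysis.Analysis"
begin

section \<open>Domains with smooth boundary\<close>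

definition C1_with_grad :: "('a::euclidean_space \<Rightarrow> real) \<Rightarrow> ('a \<Rightarrow> 'a) \<Rightarrow> bool" where
  "C1_with_grad \<phi> g \<longleftrightarrow> (\<forall>x. GDERIV \<phi> x :> g x) \<and> continuous_on UNIV g"

text \<open>Inside the open set \<open>U\<close>, the set \<open>\<Omega>\<close> is the subgraph of \<open>h\<close> in the direction of the signed
  coordinate axis \<open>\<nu>\<close>. The function \<open>h\<close> lives on the hyperplane orthogonal to \<open>\<nu>\<close>; it is
  represented as a function on the whole space that is constant along \<open>\<nu>\<close>.\<close>

definition graph_chart ::
    "'a::euclidean_space set \<Rightarrow> 'a set \<Rightarrow> 'a \<Rightarrow> ('a \<Rightarrow> real) \<Rightarrow> ('a \<Rightarrow> 'a) \<Rightarrow> bool" where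
  "graph_chart \<Omega> U \<nu> h g \<longleftrightarrow>
     open U \<and> (\<nu> \<in> Basis \<or> - \<nu> \<in> Basis) \<and> C1_with_grad h g \<and>
     (\<forall>x r. h (x + r *\<^sub>R \<nu>) = h x) \<and>
     \<Omega> \<inter> U = {x \<in> U. x \<bullet> \<nu> < h x}"

text \<open>``Sufficiently smooth'' is read as \<open>C\<^sup>1\<close>, which is what the outward normal, the surface
  measure and the boundary traces below require.\<close>

definition bounded_smooth_domain :: "'a::euclidean_space set \<Rightarrow> bool" where
  "bounded_smooth_domain \<Omega> \<longleftrightarrow>
     \<Omega> \<noteq> {} \<and> open \<Omega> \<and> connected \<Omega> \<and> bounded \<Omega> \<and>
     (\<forall>p\<in>frontier \<Omega>. \<exists>U \<nu> h g. p \<in> U \<and> graph_chart \<Omega> U \<nu> h g)"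

text \<open>The unit vector \<open>n\<close> such that directions at an obtuse angle to \<open>n\<close> enter \<open>\<Omega>\<close> and those at an
  acute angle leave it. In a graph chart this is \<open>(\<nu> - g p) / sqrt (1 + \<bar>g p\<bar>\<^sup>2)\<close>.\<close>

definition outward_unit_normal :: "'a::euclidean_space set \<Rightarrow> 'a \<Rightarrow> 'a" where
  "outward_unit_normal \<Omega> p =
     (THE n. norm n = 1 \<and>
        (\<forall>v. v \<bullet> n < 0 \<longrightarrow> (\<forall>\<^sub>F r in at_right 0. p + r *\<^sub>R v \<in> \<Omega>)) \<and>
        (\<forall>v. v \<bullet> n > 0 \<longrightarrow> (\<forall>\<^sub>F r in at_right 0. p + r *\<^sub>R v \<notin> \<Omega>)))"

text \<open>Lebesgue measure on the coordinate hyperplane orthogonal to \<open>\<nu>\<close>, of dimension one less than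
  the space (a point mass at \<open>0\<close> if the space is one-dimensional).\<close>

definition hyperplane_lborel :: "'a::euclidean_space \<Rightarrow> 'a measure" where
  "hyperplane_lborel \<nu> =
     distr (Pi\<^sub>M (Basis - {\<nu>, - \<nu>}) (\<lambda>_. lborel)) borel
       (\<lambda>y. \<Sum>i\<in>Basis - {\<nu>, - \<nu>}. y i *\<^sub>R i)"

text \<open>\<open>\<sigma>\<close> is the surface measure of \<open>\<partial>\<Omega>\<close>, regarded as a Borel measure on the whole space that is
  concentrated on \<open>\<partial>\<Omega>\<close>: in every graph chart its area element is \<open>sqrt (1 + \<bar>\<nabla>h\<bar>\<^sup>2) dy\<close>.
  Since \<open>\<partial>\<Omega>\<close> is covered by charts, this determines \<open>\<sigma>\<close> uniquely.\<close>

definition is_surface_measure :: "'a::euclidean_space set \<Rightarrow> 'a measure \<Rightarrow> bool" where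
  "is_surface_measure \<Omega> \<sigma> \<longleftrightarrow>
     sets \<sigma> = sets borel \<and> emeasure \<sigma> (- frontier \<Omega>) = 0 \<and>
     (\<forall>U \<nu> h g A. graph_chart \<Omega> U \<nu> h g \<and> A \<in> sets borel \<and> A \<subseteq> frontier \<Omega> \<inter> U \<longrightarrow>
        emeasure \<sigma> A =
          (\<integral>\<^sup>+ y. ennreal (sqrt (1 + (norm (g y))\<^sup>2)) * indicator A (y + h y *\<^sub>R \<nu>)
             \<partial>hyperplane_lborel \<nu>))"


section \<open>Square-integrable functions, weak derivatives and traces\<close>

text \<open>Elements of \<open>L\<^sup>2\<close> and of Sobolev spaces are represented by functions, so equations between
  them are understood almost everywhere.\<close>

definition L2_fun :: "'a measure \<Rightarrow> ('a \<Rightarrow> 'b::euclidean_space) \<Rightarrow> bool" where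
  "L2_fun M v \<longleftrightarrow> v \<in> borel_measurable M \<and> integrable M (\<lambda>x. (norm (v x))\<^sup>2)"

definition L2_norm :: "'a measure \<Rightarrow> ('a \<Rightarrow> 'b::euclidean_space) \<Rightarrow> real" where
  "L2_norm M v = sqrt (\<integral>x. (norm (v x))\<^sup>2 \<partial>M)"

definition L2_inner :: "'a measure \<Rightarrow> ('a \<Rightarrow> 'b::euclidean_space) \<Rightarrow> ('a \<Rightarrow> 'b) \<Rightarrow> real" where
  "L2_inner M v w = (\<integral>x. v x \<bullet> w x \<partial>M)"

definition has_weak_grad ::
    "'a::euclidean_space set \<Rightarrow> ('a \<Rightarrow> real) \<Rightarrow> ('a \<Rightarrow> 'a) \<Rightarrow> bool" where
  "has_weak_grad \<Omega> v G \<longleftrightarrow>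
     L2_fun (lebesgue_on \<Omega>) v \<and> L2_fun (lebesgue_on \<Omega>) G \<and>
     (\<forall>\<phi> g. C1_with_grad \<phi> g \<and> (\<exists>K. compact K \<and> K \<subseteq> \<Omega> \<and> (\<forall>x. x \<notin> K \<longrightarrow> \<phi> x = 0)) \<longrightarrow>
        (\<integral>x. v x *\<^sub>R g x \<partial>lebesgue_on \<Omega>) = - (\<integral>x. \<phi> x *\<^sub>R G x \<partial>lebesgue_on \<Omega>))"

text \<open>The weak gradient is unique only up to null sets; a representative is chosen.\<close>

definition weak_grad :: "'a::euclidean_space set \<Rightarrow> ('a \<Rightarrow> real) \<Rightarrow> 'a \<Rightarrow> 'a" where
  "weak_grad \<Omega> v = (SOME G. has_weak_grad \<Omega> v G)"

definition weak_partial :: "'a::euclidean_space set \<Rightarrow> 'a \<Rightarrow> ('a \<Rightarrow> real) \<Rightarrow> 'a \<Rightarrow> real" where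
  "weak_partial \<Omega> i v = (\<lambda>x. weak_grad \<Omega> v x \<bullet> i)"

definition weak_laplacian :: "'a::euclidean_space set \<Rightarrow> ('a \<Rightarrow> real) \<Rightarrow> 'a \<Rightarrow> real" where
  "weak_laplacian \<Omega> v = (\<lambda>x. \<Sum>i\<in>Basis. weak_partial \<Omega> i (weak_partial \<Omega> i v) x)"

definition H1 :: "'a::euclidean_space set \<Rightarrow> ('a \<Rightarrow> real) set" where
  "H1 \<Omega> = {v. \<exists>G. has_weak_grad \<Omega> v G}"

definition H2 :: "'a::euclidean_space set \<Rightarrow> ('a \<Rightarrow> real) set" where
  "H2 \<Omega> = {v \<in> H1 \<Omega>. \<forall>i\<in>Basis. weak_partial \<Omega> i v \<in> H1 \<Omega>}"

text \<open>The trace operator is the closure of the restriction map of \<open>C\<^sup>1\<close> functions to \<open>\<partial>\<Omega>\<close>, with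
  respect to convergence in \<open>H\<^sup>1(\<Omega>)\<close> and in \<open>L\<^sup>2(\<partial>\<Omega>)\<close>.\<close>

definition has_trace ::
    "'a::euclidean_space set \<Rightarrow> 'a measure \<Rightarrow> ('a \<Rightarrow> real) \<Rightarrow> ('a \<Rightarrow> real) \<Rightarrow> bool" where
  "has_trace \<Omega> \<sigma> v \<gamma> \<longleftrightarrow>
     v \<in> H1 \<Omega> \<and> L2_fun \<sigma> \<gamma> \<and>
     (\<exists>\<phi> g. (\<forall>k::nat. C1_with_grad (\<phi> k) (g k)) \<and>
        (\<lambda>k. L2_norm (lebesgue_on \<Omega>) (\<lambda>x. \<phi> k x - v x)) \<longlonglongrightarrow> 0 \<and>
        (\<lambda>k. L2_norm (lebesgue_on \<Omega>) (\<lambda>x. g k x - weak_grad \<Omega> v x)) \<longlonglongrightarrow> 0 \<and>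
        (\<lambda>k. L2_norm \<sigma> (\<lambda>x. \<phi> k x - \<gamma> x)) \<longlonglongrightarrow> 0)"

definition boundary_trace ::
    "'a::euclidean_space set \<Rightarrow> 'a measure \<Rightarrow> ('a \<Rightarrow> real) \<Rightarrow> 'a \<Rightarrow> real" where
  "boundary_trace \<Omega> \<sigma> v = (SOME \<gamma>. has_trace \<Omega> \<sigma> v \<gamma>)"

definition normal_derivative ::
    "'a::euclidean_space set \<Rightarrow> 'a measure \<Rightarrow> ('a \<Rightarrow> real) \<Rightarrow> 'a \<Rightarrow> real" where
  "normal_derivative \<Omega> \<sigma> v =
     (\<lambda>x. \<Sum>i\<in>Basis. boundary_trace \<Omega> \<sigma> (weak_partial \<Omega> i v) x * (outward_unit_normal \<Omega> x \<bullet> i))"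


section \<open>Strong solutions\<close>

definition time_interval :: "ereal \<Rightarrow> real set" where
  "time_interval T = {t. 0 \<le> t \<and> ereal t < T}"

definition L2_continuous ::
    "real set \<Rightarrow> 'a measure \<Rightarrow> (real \<Rightarrow> 'a \<Rightarrow> 'b::euclidean_space) \<Rightarrow> bool" where
  "L2_continuous I M w \<longleftrightarrow>
     (\<forall>t\<in>I. L2_fun M (w t) \<and>
        ((\<lambda>s. L2_norm M (\<lambda>x. w s x - w t x)) \<longlongrightarrow> 0) (at t within I))"

definition L2_has_derivative ::
    "real set \<Rightarrow> 'a measure \<Rightarrow> (real \<Rightarrow> 'a \<Rightarrow> 'b::euclidean_space) \<Rightarrow> (real \<Rightarrow> 'a \<Rightarrow> 'b) \<Rightarrow> bool" where
  "L2_has_derivative I M w w' \<longleftrightarrow>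
     (\<forall>t\<in>I. L2_fun M (w t) \<and> L2_fun M (w' t) \<and>
        ((\<lambda>s. L2_norm M (\<lambda>x. (w s x - w t x) /\<^sub>R (s - t) - w' t x)) \<longlongrightarrow> 0) (at t within I))"

text \<open>\<open>u \<in> C([0,T); H\<^sup>2(\<Omega>)) \<inter> C\<^sup>1([0,T); H\<^sup>1(\<Omega>)) \<inter> C\<^sup>2([0,T); L\<^sup>2(\<Omega>))\<close> with time derivatives \<open>ut\<close>
  and \<open>utt\<close>.\<close>

definition strong_regularity ::
    "'a::euclidean_space set \<Rightarrow> ereal \<Rightarrow> (real \<Rightarrow> 'a \<Rightarrow> real) \<Rightarrow> (real \<Rightarrow> 'a \<Rightarrow> real) \<Rightarrow>
     (real \<Rightarrow> 'a \<Rightarrow> real) \<Rightarrow> bool" where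
  "strong_regularity \<Omega> T u ut utt \<longleftrightarrow>
     (let I = time_interval T; M = lebesgue_on \<Omega> in
       (\<forall>t\<in>I. u t \<in> H2 \<Omega> \<and> ut t \<in> H1 \<Omega>) \<and>
       L2_continuous I M u \<and>
       L2_continuous I M (\<lambda>t. weak_grad \<Omega> (u t)) \<and>
       (\<forall>i\<in>Basis. L2_continuous I M (\<lambda>t. weak_grad \<Omega> (weak_partial \<Omega> i (u t)))) \<and>
       L2_has_derivative I M u ut \<and>
       L2_has_derivative I M (\<lambda>t. weak_grad \<Omega> (u t)) (\<lambda>t. weak_grad \<Omega> (ut t)) \<and>
       L2_continuous I M ut \<and>
       L2_continuous I M (\<lambda>t. weak_grad \<Omega> (ut t)) \<and>
       L2_has_derivative I M ut utt \<and>
       L2_continuous I M utt)"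

text \<open>By the trace theorem the functions \<open>u t\<close> and \<open>weak_partial \<Omega> i (u t)\<close> in \<open>H1 \<Omega>\<close> always have
  traces. This is recorded in the boundary condition, so that \<open>boundary_trace\<close>, which is defined
  by choice, can be used without first proving that theorem.\<close>

definition strong_solution ::
    "'a::euclidean_space set \<Rightarrow> 'a measure \<Rightarrow> real \<Rightarrow> (real \<Rightarrow> real) \<Rightarrow> ('a \<Rightarrow> real) \<Rightarrow> ('a \<Rightarrow> real) \<Rightarrow>
     ereal \<Rightarrow> (real \<Rightarrow> 'a \<Rightarrow> real) \<Rightarrow> (real \<Rightarrow> 'a \<Rightarrow> real) \<Rightarrow> (real \<Rightarrow> 'a \<Rightarrow> real) \<Rightarrow> bool" where
  "strong_solution \<Omega> \<sigma> b f u0 u1 T u ut utt \<longleftrightarrow>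
     0 < T \<and> strong_regularity \<Omega> T u ut utt \<and>
     (\<forall>t\<in>time_interval T. AE x in lebesgue_on \<Omega>.
        utt t x - weak_laplacian \<Omega> (u t) x + b * u t x = 0) \<and>
     (AE x in lebesgue_on \<Omega>. u 0 x = u0 x) \<and>
     (AE x in lebesgue_on \<Omega>. ut 0 x = u1 x) \<and>
     (\<forall>t\<in>time_interval T.
        (\<exists>\<gamma>. has_trace \<Omega> \<sigma> (u t) \<gamma>) \<and>
        (\<forall>i\<in>Basis. \<exists>\<gamma>. has_trace \<Omega> \<sigma> (weak_partial \<Omega> i (u t)) \<gamma>) \<and>
        (AE x in \<sigma>. normal_derivative \<Omega> \<sigma> (u t) x = f (boundary_trace \<Omega> \<sigma> (u t) x)))"

text \<open>\<open>[0,T)\<close> is a maximal interval of existence of \<open>u\<close> if \<open>u\<close> is not extendable. For finite \<open>T\<close> this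
  alone does not make the \<open>L\<^sup>2\<close> norm unbounded: on an interval with \<open>f s = \<bar>s\<bar>^(p - 1) * s\<close> and \<open>p > 3\<close>, the
  boundary values can blow up like \<open>(T - t)\<close> to the power \<open>- 1 / (p - 1)\<close> while the \<open>L\<^sup>2\<close> norm stays
  bounded. Blow-up of the \<open>L\<^sup>2\<close> norm at \<open>T\<close> therefore presupposes solvability in the sense that a
  solution whose \<open>L\<^sup>2\<close> norm is bounded on a finite interval can be continued.\<close>

definition extendable ::
    "'a::euclidean_space set \<Rightarrow> 'a measure \<Rightarrow> real \<Rightarrow> (real \<Rightarrow> real) \<Rightarrow> ('a \<Rightarrow> real) \<Rightarrow> ('a \<Rightarrow> real) \<Rightarrow>
     ereal \<Rightarrow> (real \<Rightarrow> 'a \<Rightarrow> real) \<Rightarrow> bool" where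
  "extendable \<Omega> \<sigma> b f u0 u1 T u \<longleftrightarrow>
     (\<exists>T' v vt vtt. T < T' \<and> strong_solution \<Omega> \<sigma> b f u0 u1 T' v vt vtt \<and>
        (\<forall>t\<in>time_interval T. AE x in lebesgue_on \<Omega>. v t x = u t x))"


section \<open>Energy\<close>

definition primitive :: "(real \<Rightarrow> real) \<Rightarrow> real \<Rightarrow> real" where
  "primitive f s = (LBINT \<tau>=ereal 0..ereal s. f \<tau>)"

definition energy ::
    "'a::euclidean_space set \<Rightarrow> 'a measure \<Rightarrow> real \<Rightarrow> (real \<Rightarrow> real) \<Rightarrow> ('a \<Rightarrow> real) \<Rightarrow> ('a \<Rightarrow> real) \<Rightarrow>
     real" where
  "energy \<Omega> \<sigma> b f v w =
     1/2 * (L2_norm (lebesgue_on \<Omega>) w)\<^sup>2 + 1/2 * (L2_norm (lebesgue_on \<Omega>) (weak_grad \<Omega> v))\<^sup>2 +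
     b/2 * (L2_norm (lebesgue_on \<Omega>) v)\<^sup>2 -
     (\<integral>x. primitive f (boundary_trace \<Omega> \<sigma> v x) \<partial>\<sigma>)"

end

theory Submission
  imports Defs
begin

text \<open>
  Let \<open>\<Psi> t = \<parallel>u t\<parallel>\<^sup>2\<close>. Then \<open>\<Psi>' = 2 \<langle>u, ut\<rangle>\<close> and \<open>\<Psi>'' = 2 \<parallel>ut\<parallel>\<^sup>2 + 2 \<langle>u, utt\<rangle>\<close>. Testing the equation with \<open>u\<close> and
  integrating by parts turns \<open>\<langle>u, utt\<rangle>\<close> into \<open>- \<parallel>\<nabla>u\<parallel>\<^sup>2 - b \<parallel>u\<parallel>\<^sup>2\<close> plus the boundary integral of \<open>u f(u)\<close>. The
  growth condition bounds this integral from below by \<open>2 (1 + 2 \<alpha>)\<close> times that of \<open>F(u)\<close>, minus \<open>R0\<close>, and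
  the energy equality expresses the latter through \<open>E0\<close> and the other norms. The factor \<open>2 (1 + 2 \<alpha>)\<close> is large
  enough to turn the signs of the elastic terms, which can then be dropped:
  \<open>\<Psi>'' \<ge> 4 (1 + \<alpha>) \<parallel>ut\<parallel>\<^sup>2 - 2 (1 + 2 \<alpha>) K\<close> with \<open>K = 2 E0 + R0 / (1 + 2 \<alpha>)\<close>. By the Cauchy-Schwarz inequality
  \<open>\<Psi> \<Psi>'' - (1 + \<alpha>) \<Psi>'\<^sup>2 \<ge> - 2 (1 + 2 \<alpha>) K \<Psi>\<close>.

  This is the situation of Levine's concavity method, treated in the locale \<open>concavity_inequality\<close>. The
  quantity \<open>\<Psi> powr (- 2 \<alpha> - 2) * (\<Psi>'\<^sup>2 - 4 K \<Psi>)\<close> is nondecreasing as long as \<open>\<Psi>' > 0\<close>, and the assumption on the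
  initial data says exactly that it starts positive. Hence \<open>\<Psi>'\<close> stays positive, and \<open>\<Psi> powr (- \<alpha>)\<close> decreases at a
  speed bounded away from \<open>0\<close>. As it is positive, time is bounded. Since \<open>\<Psi>\<close> is monotone, it has a limit at the end
  of its interval of existence; a finite limit would make the solution extendable, so the limit is infinite.

  The analytic core is Green's identity \<open>green_identity\<close> for functions with weak derivatives in a \<open>C\<^sup>1\<close>
  domain. It follows by density, built into the definition of traces, from the divergence theorem for
  continuously differentiable functions (\<open>divergence_theorem\<close>). In a chart, where the domain is a subgraph, a
  volume-preserving shear flattens the boundary, and the fundamental theorem of calculus on lines applies
  (\<open>divergence_subgraph\<close>); cutoff functions pass from charts to the whole domain.
\<close>

section \<open>Continuously differentiable functions\<close>

lemma C1_with_grad_continuous: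
  assumes "C1_with_grad \<phi> g" shows "continuous_on S \<phi>" "continuous_on S g"
  using assms unfolding C1_with_grad_def gderiv_def
  by (auto intro: has_derivative_continuous_on[where f' = "\<lambda>x h. h \<bullet> g x"] has_derivative_at_withinI
           continuous_on_subset)

lemma C1_with_grad_measurable [measurable_dest]:
  assumes "C1_with_grad \<phi> g" shows "\<phi> \<in> borel_measurable borel" "g \<in> borel_measurable borel"
  using C1_with_grad_continuous[OF assms] by (auto intro: borel_measurable_continuous_onI)

lemma C1_with_grad_const: "C1_with_grad (\<lambda>x. c) (\<lambda>x. 0)"
  by (auto simp: C1_with_grad_def intro: GDERIV_const)

lemma C1_with_grad_add:
  assumes "C1_with_grad \<phi> g" "C1_with_grad \<psi> k"
  shows "C1_with_grad (\<lambda>x. \<phi> x + \<psi> x) (\<lambda>x. g x + k x)"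
  using assms unfolding C1_with_grad_def
  by (auto intro!: GDERIV_add continuous_intros)

lemma C1_with_grad_diff:
  assumes "C1_with_grad \<phi> g" "C1_with_grad \<psi> k"
  shows "C1_with_grad (\<lambda>x. \<phi> x - \<psi> x) (\<lambda>x. g x - k x)"
  using assms unfolding C1_with_grad_def
  by (auto intro!: GDERIV_diff continuous_intros)

lemma C1_with_grad_mult:
  assumes "C1_with_grad \<phi> g" "C1_with_grad \<psi> k"
  shows "C1_with_grad (\<lambda>x. \<phi> x * \<psi> x) (\<lambda>x. \<phi> x *\<^sub>R k x + \<psi> x *\<^sub>R g x)"
  using assms C1_with_grad_continuous[of _ _ UNIV] unfolding C1_with_grad_def
  by (auto intro!: GDERIV_mult continuous_intros)

lemma C1_with_grad_inverse:
  assumes "C1_with_grad \<phi> g" "\<And>x. \<phi> x \<noteq> 0"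
  shows "C1_with_grad (\<lambda>x. inverse (\<phi> x)) (\<lambda>x. - (inverse (\<phi> x))\<^sup>2 *\<^sub>R g x)"
  unfolding C1_with_grad_def
  using assms(2) C1_with_grad_continuous[OF assms(1), of UNIV]
    GDERIV_inverse[OF assms(1)[unfolded C1_with_grad_def, THEN conjunct1, THEN spec] assms(2)]
  by (auto intro!: continuous_intros simp del: scaleR_minus_left)

lemma C1_with_grad_compose:
  assumes "C1_with_grad \<phi> g" "\<And>t. (q has_real_derivative q' t) (at t)" "continuous_on UNIV q'"
  shows "C1_with_grad (\<lambda>x. q (\<phi> x)) (\<lambda>x. q' (\<phi> x) *\<^sub>R g x)"
  unfolding C1_with_grad_def
proof
  show "\<forall>x. GDERIV (\<lambda>x. q (\<phi> x)) x :> q' (\<phi> x) *\<^sub>R g x"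
    using GDERIV_DERIV_compose[OF _ assms(2)] assms(1) unfolding C1_with_grad_def by blast
  have "continuous_on UNIV (\<lambda>x. q' (\<phi> x))"
    by (rule continuous_on_compose2[OF assms(3) C1_with_grad_continuous(1)[OF assms(1)]]) auto
  then show "continuous_on UNIV (\<lambda>x. q' (\<phi> x) *\<^sub>R g x)"
    by (intro continuous_intros C1_with_grad_continuous[OF assms(1)])
qed

lemma C1_with_grad_unique:
  assumes "C1_with_grad \<phi> g" "C1_with_grad \<phi> k" shows "g = k"
proof
  fix x
  have "(\<lambda>h. h \<bullet> g x) = (\<lambda>h. h \<bullet> k x)"
    using assms unfolding C1_with_grad_def gderiv_def by (blast intro: has_derivative_unique)
  then show "g x = k x"
    by (metis inner_eq_zero_iff inner_diff_right diff_self right_minus_eq)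
qed

lemma C1_with_grad_eq_0:
  assumes "C1_with_grad \<phi> g" "open W" "\<And>x. x \<in> W \<Longrightarrow> \<phi> x = 0" "x \<in> W"
  shows "g x = 0"
proof -
  have "((\<lambda>_. 0) has_derivative (\<lambda>h. h \<bullet> g x)) (at x)"
    using assms unfolding C1_with_grad_def gderiv_def
    by (metis has_derivative_transform_within_open)
  then have "(\<lambda>h. h \<bullet> g x) = (\<lambda>h. 0)"
    by (rule has_derivative_unique) simp
  then show ?thesis
    by (metis inner_eq_zero_iff)
qed

lemma C1_with_grad_zero_outside:
  assumes "C1_with_grad \<phi> G" "compact K" "\<And>x. x \<notin> K \<Longrightarrow> \<phi> x = 0" "x \<notin> K"
  shows "G x = 0"
  using C1_with_grad_eq_0[OF assms(1), of "- K" x] assms by (auto simp: compact_imp_closed open_Compl)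

lemma C1_with_grad_line:
  assumes "C1_with_grad \<phi> g"
  shows "((\<lambda>s. \<phi> (y + s *\<^sub>R v)) has_real_derivative (g (y + s *\<^sub>R v) \<bullet> v)) (at s within S)"
proof -
  have "((\<lambda>s. \<phi> (y + s *\<^sub>R v)) has_derivative (\<lambda>t. (t *\<^sub>R v) \<bullet> g (y + s *\<^sub>R v))) (at s within S)"
    using assms unfolding C1_with_grad_def gderiv_def
    by (intro has_derivative_compose[of "\<lambda>s. y + s *\<^sub>R v" "\<lambda>t. t *\<^sub>R v" _ _ \<phi>])
       (auto intro!: derivative_eq_intros)
  then show ?thesis
    by (simp add: has_field_derivative_def inner_commute mult.commute mult_commute_abs)
qed

lemma isCont_grad_line:
  assumes "C1_with_grad \<phi> g"
  shows "isCont (\<lambda>s. g (y + s *\<^sub>R v) \<bullet> v) s"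
proof -
  have "continuous_on UNIV (\<lambda>s. g (y + s *\<^sub>R v))"
    by (rule continuous_on_compose2[OF C1_with_grad_continuous(2)[OF assms, of UNIV]])
       (auto intro!: continuous_intros)
  then show ?thesis
    by (auto simp: continuous_on_eq_continuous_at intro!: continuous_intros)
qed

text \<open>A function that is invariant under translation along \<open>v\<close> has no derivative in that direction, and
  its gradient inherits the invariance by uniqueness of gradients.\<close>

lemma C1_with_grad_orthogonal:
  assumes h: "C1_with_grad h g" and inv: "\<And>x r. h (x + r *\<^sub>R v) = h x"
  shows "g x \<bullet> v = 0" "g (x + r *\<^sub>R v) = g x"
proof -
  have "((\<lambda>s. h (x + s *\<^sub>R v)) has_real_derivative (g (x + 0 *\<^sub>R v) \<bullet> v)) (at 0)"
    by (rule C1_with_grad_line[OF h])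
  then have "((\<lambda>s. h x) has_real_derivative (g x \<bullet> v)) (at 0)"
    by (simp add: inv)
  then show "g x \<bullet> v = 0"
    by (rule DERIV_unique) simp
  have "C1_with_grad h (\<lambda>x. g (x + r *\<^sub>R v))"
    unfolding C1_with_grad_def
  proof
    have "GDERIV (\<lambda>x. h (x + r *\<^sub>R v)) x :> g (x + r *\<^sub>R v)" for x
      using h unfolding C1_with_grad_def gderiv_def
      by (intro has_derivative_compose[of "\<lambda>x. x + r *\<^sub>R v" "\<lambda>t. t" _ _ h])
         (auto intro!: derivative_eq_intros)
    then show "\<forall>x. GDERIV h x :> g (x + r *\<^sub>R v)"
      unfolding inv by blast
    show "continuous_on UNIV (\<lambda>x. g (x + r *\<^sub>R v))"
      by (intro continuous_on_compose2[OF C1_with_grad_continuous(2)[OF h, of UNIV]] continuous_intros) auto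
  qed
  from C1_with_grad_unique[OF h this] show "g (x + r *\<^sub>R v) = g x"
    by metis
qed

text \<open>The remainder in the first-order expansion of this function at any point is at most \<open>d\<^sup>2\<close>.\<close>

lemma has_real_derivative_square_max_0:
  "((\<lambda>t::real. (max 0 t)\<^sup>2) has_real_derivative 2 * max 0 t) (at t)"
  unfolding DERIV_def
proof (rule LIM_zero_cancel)
  have bound: "\<bar>(max 0 (t + d))\<^sup>2 - (max 0 t)\<^sup>2 - 2 * max 0 t * d\<bar> \<le> d\<^sup>2" for d
  proof -
    consider "t \<le> 0" "t + d \<le> 0" | "t \<le> 0" "t + d > 0" | "t > 0" "t + d > 0" | "t > 0" "t + d \<le> 0"
      by linarith
    then show ?thesis
    proof cases
      case 2
      then have "(t + d)\<^sup>2 \<le> d\<^sup>2"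
        by (intro power_mono) auto
      then show ?thesis
        using 2 by (simp add: max_def)
    next
      case 4
      then have "t * (t + d) \<le> 0"
        by (simp add: mult_le_0_iff)
      moreover have "t * d \<le> 0"
        using 4 by (simp add: mult_le_0_iff)
      moreover have "(t + d)\<^sup>2 \<ge> 0"
        by simp
      ultimately show ?thesis
        using 4 by (simp add: max_def power2_eq_square algebra_simps abs_if)
    qed (auto simp: max_def power2_eq_square algebra_simps)
  qed
  have "\<bar>((max 0 (t + d))\<^sup>2 - (max 0 t)\<^sup>2) / d - 2 * max 0 t\<bar> \<le> \<bar>d\<bar>" if "d \<noteq> 0" for d
  proof -
    have "((max 0 (t + d))\<^sup>2 - (max 0 t)\<^sup>2) / d - 2 * max 0 t =
        ((max 0 (t + d))\<^sup>2 - (max 0 t)\<^sup>2 - 2 * max 0 t * d) / d"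
      using that by (simp add: field_simps)
    also have "\<bar>\<dots>\<bar> \<le> d\<^sup>2 / \<bar>d\<bar>"
      using bound[of d] by (auto simp: abs_divide intro!: divide_right_mono)
    also have "d\<^sup>2 / \<bar>d\<bar> = \<bar>d\<bar>"
      using that by (simp add: power2_eq_square abs_if)
    finally show ?thesis .
  qed
  then have ev: "\<forall>\<^sub>F d in at 0. norm (((max 0 (t + d))\<^sup>2 - (max 0 t)\<^sup>2) / d - 2 * max 0 t) \<le> \<bar>d\<bar>"
    by (auto simp: eventually_at_filter intro!: always_eventually)
  show "((\<lambda>d. ((max 0 (t + d))\<^sup>2 - (max 0 t)\<^sup>2) / d - 2 * max 0 t) \<longlongrightarrow> 0) (at 0)"
    by (rule Lim_null_comparison[OF ev]) (intro tendsto_rabs_zero tendsto_ident_at)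
qed

text \<open>Take the quotient of \<open>(max 0 (r\<^sup>2 - \<rho>))\<^sup>2\<close> by its sum with \<open>(max 0 (\<rho> - (r / 2)\<^sup>2))\<^sup>2\<close>, where \<open>\<rho>\<close> is the squared
  distance to \<open>p\<close>.\<close>

lemma exists_C1_bump:
  fixes p :: "'a::euclidean_space"
  assumes r: "r > 0"
  obtains \<theta> g where "C1_with_grad \<theta> g" "\<And>x. x \<notin> cball p r \<Longrightarrow> \<theta> x = 0"
    "\<And>x. x \<in> ball p (r / 2) \<Longrightarrow> \<theta> x = 1"
proof -
  define m :: "real \<Rightarrow> real" where "m t = (max 0 t)\<^sup>2" for t
  define \<rho> where "\<rho> x = (x - p) \<bullet> (x - p)" for x
  have rho: "C1_with_grad \<rho> (\<lambda>x. 2 *\<^sub>R (x - p))"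
    unfolding C1_with_grad_def \<rho>_def gderiv_def
    by (auto intro!: derivative_eq_intros continuous_intros simp: inner_commute)
  have mc: "\<exists>g. C1_with_grad (\<lambda>x. m (\<phi> x)) g" if "C1_with_grad \<phi> k" for \<phi> :: "'a \<Rightarrow> real" and k
    unfolding m_def
    by (rule exI, rule C1_with_grad_compose[OF that has_real_derivative_square_max_0])
       (intro continuous_intros)
  obtain g1 where g1: "C1_with_grad (\<lambda>x. m (r\<^sup>2 - \<rho> x)) g1"
    using mc[OF C1_with_grad_diff[OF C1_with_grad_const rho]] by blast
  obtain g2 where g2: "C1_with_grad (\<lambda>x. m (\<rho> x - (r / 2)\<^sup>2)) g2"
    using mc[OF C1_with_grad_diff[OF rho C1_with_grad_const]] by blast
  \<comment> \<open>The two summands of the denominator cannot vanish together since \<open>(r / 2)\<^sup>2 < r\<^sup>2\<close>.\<close>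
  let ?\<theta> = "\<lambda>x. m (r\<^sup>2 - \<rho> x) * inverse (m (r\<^sup>2 - \<rho> x) + m (\<rho> x - (r / 2)\<^sup>2))"
  have lt: "(r / 2)\<^sup>2 < r\<^sup>2"
    using r by (intro power_strict_mono) auto
  have nz: "m (r\<^sup>2 - \<rho> x) + m (\<rho> x - (r / 2)\<^sup>2) \<noteq> 0" for x
    using lt by (auto simp: m_def add_nonneg_eq_0_iff max_def split: if_splits)
  have C1: "\<exists>g. C1_with_grad ?\<theta> g"
    using C1_with_grad_mult[OF g1 C1_with_grad_inverse[OF C1_with_grad_add[OF g1 g2] nz]] by blast
  have \<rho>: "\<rho> x = (dist p x)\<^sup>2" for x
    by (simp add: \<rho>_def power2_norm_eq_inner[symmetric] dist_norm norm_minus_commute)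
  have 0: "?\<theta> x = 0" if "x \<notin> cball p r" for x
  proof -
    have "r\<^sup>2 \<le> \<rho> x"
      unfolding \<rho> using that r by (intro power_mono) auto
    then show ?thesis
      by (simp add: m_def)
  qed
  have 1: "?\<theta> x = 1" if "x \<in> ball p (r / 2)" for x
  proof -
    have "\<rho> x \<le> (r / 2)\<^sup>2"
      unfolding \<rho> using that by (intro power_mono) auto
    then have "m (\<rho> x - (r / 2)\<^sup>2) = 0"
      by (simp add: m_def)
    then show ?thesis
      using nz[of x] by simp
  qed
  show thesis
    using C1 0 1 that by blast
qed

section \<open>Integration along lines parallel to a coordinate axis\<close>

definition signed_axis :: "'a::euclidean_space \<Rightarrow> bool" where
  "signed_axis \<nu> \<longleftrightarrow> \<nu> \<in> Basis \<or> - \<nu> \<in> Basis"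

lemma minus_Basis_not_Basis: "b \<in> Basis \<Longrightarrow> - b \<notin> (Basis :: 'a::euclidean_space set)"
  by (metis inner_Basis inner_minus_left neg_0_le_iff_le nle_le not_one_le_zero zero_neq_neg_one
      zero_neq_one)

lemma signed_axis_norm: "signed_axis \<nu> \<Longrightarrow> \<nu> \<bullet> \<nu> = 1"
  by (auto simp: signed_axis_def dest: inner_same_Basis)

lemma sets_hyperplane_lborel [measurable_cong, simp]: "sets (hyperplane_lborel \<nu>) = sets borel"
  by (simp add: hyperplane_lborel_def)

lemma space_hyperplane_lborel [simp]: "space (hyperplane_lborel \<nu>) = UNIV"
  by (simp add: hyperplane_lborel_def)

lemma hyperplane_lborel_minus: "hyperplane_lborel (- \<nu>) = hyperplane_lborel \<nu>"
  by (simp add: hyperplane_lborel_def insert_commute)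

lemma AE_hyperplane_lborel_orthogonal:
  assumes "signed_axis \<nu>"
  shows "AE y in hyperplane_lborel \<nu>. y \<bullet> \<nu> = 0"
proof -
  let ?I = "Basis - {\<nu>, - \<nu>}"
  have orth: "i \<bullet> \<nu> = 0" if "i \<in> ?I" for i
    using that assms by (force simp: signed_axis_def inner_Basis dest: inner_not_same_Basis[of i "- \<nu>"])
  show ?thesis
    unfolding hyperplane_lborel_def
    by (subst AE_distr_iff) (auto simp: inner_sum_left orth intro!: always_eventually sum.neutral)
qed

interpretation lborel_coords: product_sigma_finite "\<lambda>_::'a::euclidean_space. lborel :: real measure" ..

text \<open>Tonelli's theorem in the coordinates of the basis: the coordinate along \<open>\<nu>\<close> is integrated first. If
  \<open>\<nu>\<close> is the negative of a basis vector, reflecting the parameter reduces to that vector.\<close>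

lemma nn_integral_lborel_lines:
  fixes F :: "'a::euclidean_space \<Rightarrow> ennreal"
  assumes axis: "signed_axis \<nu>" and F[measurable]: "F \<in> borel_measurable borel"
  shows "(\<integral>\<^sup>+x. F x \<partial>lborel) = (\<integral>\<^sup>+y. (\<integral>\<^sup>+s. F (y + s *\<^sub>R \<nu>) \<partial>lborel) \<partial>hyperplane_lborel \<nu>)"
proof -
  have *: "(\<integral>\<^sup>+x. F x \<partial>lborel) = (\<integral>\<^sup>+y. (\<integral>\<^sup>+s. F (y + s *\<^sub>R e) \<partial>lborel) \<partial>hyperplane_lborel e)"
    if e: "e \<in> Basis" for e
  proof -
    let ?I = "Basis - {e, - e}"
    have Basis: "Basis = insert e ?I"
      using e minus_Basis_not_Basis by auto
    have upd: "(\<Sum>i\<in>?I. (x(e := s)) i *\<^sub>R i) = (\<Sum>i\<in>?I. x i *\<^sub>R i)" for x :: "'a \<Rightarrow> real" and s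
      by (intro sum.cong) auto
    have "(\<integral>\<^sup>+x. F x \<partial>lborel) =
        (\<integral>\<^sup>+f. F (\<Sum>b\<in>insert e ?I. f b *\<^sub>R b) \<partial>(\<Pi>\<^sub>M b\<in>insert e ?I. lborel))"
      by (subst lborel_eq, subst nn_integral_distr, measurable) (simp flip: Basis)
    also have "\<dots> = (\<integral>\<^sup>+x. (\<integral>\<^sup>+s. F (\<Sum>b\<in>insert e ?I. (x(e := s)) b *\<^sub>R b) \<partial>lborel)
        \<partial>(\<Pi>\<^sub>M b\<in>?I. lborel))"
      by (intro lborel_coords.product_nn_integral_insert) (auto intro: finite_subset[OF _ finite_Basis])
    also have "\<dots> = (\<integral>\<^sup>+x. (\<integral>\<^sup>+s. F ((\<Sum>b\<in>?I. x b *\<^sub>R b) + s *\<^sub>R e) \<partial>lborel)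
        \<partial>(\<Pi>\<^sub>M b\<in>?I. lborel))"
      by (subst sum.insert) (auto simp: upd fun_upd_same add.commute simp del: fun_upd_apply)
    also have "\<dots> = (\<integral>\<^sup>+y. (\<integral>\<^sup>+s. F (y + s *\<^sub>R e) \<partial>lborel) \<partial>hyperplane_lborel e)"
      unfolding hyperplane_lborel_def by (subst nn_integral_distr) auto
    finally show ?thesis .
  qed
  show ?thesis
  proof (cases "\<nu> \<in> Basis")
    case False
    then have "- \<nu> \<in> Basis"
      using axis by (auto simp: signed_axis_def)
    from *[OF this] show ?thesis
      unfolding hyperplane_lborel_minus
      by (subst nn_integral_real_affine[of _ "-1" 0]) (auto)
  qed (use * in auto)
qed

lemma integral_lborel_lines:
  fixes F :: "'a::euclidean_space \<Rightarrow> real"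
  assumes axis: "signed_axis \<nu>" and int: "integrable lborel F"
  shows "(\<integral>x. F x \<partial>lborel) = (\<integral>y. (\<integral>s. F (y + s *\<^sub>R \<nu>) \<partial>lborel) \<partial>hyperplane_lborel \<nu>)"
proof -
  have F[measurable]: "F \<in> borel_measurable borel"
    using int by auto
  have *: "(\<integral>x. F x \<partial>lborel) = (\<integral>y. (\<integral>s. F (y + s *\<^sub>R e) \<partial>lborel) \<partial>hyperplane_lborel e)"
    if e: "e \<in> Basis" for e
  proof -
    let ?I = "Basis - {e, - e}"
    have Basis: "Basis = insert e ?I"
      using e minus_Basis_not_Basis by auto
    have upd: "(\<Sum>i\<in>?I. (x(e := s)) i *\<^sub>R i) = (\<Sum>i\<in>?I. x i *\<^sub>R i)" for x :: "'a \<Rightarrow> real" and s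
      by (intro sum.cong) auto
    have int': "integrable (\<Pi>\<^sub>M b\<in>insert e ?I. lborel) (\<lambda>f. F (\<Sum>b\<in>insert e ?I. f b *\<^sub>R b))"
      using int by (subst (asm) lborel_eq, subst (asm) integrable_distr_eq) (auto simp flip: Basis)
    have "(\<integral>x. F x \<partial>lborel) =
        (\<integral>f. F (\<Sum>b\<in>insert e ?I. f b *\<^sub>R b) \<partial>(\<Pi>\<^sub>M b\<in>insert e ?I. lborel))"
      by (subst lborel_eq, subst integral_distr, measurable) (simp flip: Basis)
    also have "\<dots> = (\<integral>x. (\<integral>s. F (\<Sum>b\<in>insert e ?I. (x(e := s)) b *\<^sub>R b) \<partial>lborel)
        \<partial>(\<Pi>\<^sub>M b\<in>?I. lborel))"
      by (intro lborel_coords.product_integral_insert int') (auto intro: finite_subset[OF _ finite_Basis])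
    also have "\<dots> = (\<integral>x. (\<integral>s. F ((\<Sum>b\<in>?I. x b *\<^sub>R b) + s *\<^sub>R e) \<partial>lborel)
        \<partial>(\<Pi>\<^sub>M b\<in>?I. lborel))"
      by (subst sum.insert) (auto simp: upd fun_upd_same add.commute simp del: fun_upd_apply)
    also have "\<dots> = (\<integral>y. (\<integral>s. F (y + s *\<^sub>R e) \<partial>lborel) \<partial>hyperplane_lborel e)"
      unfolding hyperplane_lborel_def by (subst integral_distr) auto
    finally show ?thesis .
  qed
  show ?thesis
  proof (cases "\<nu> \<in> Basis")
    case False
    then have "- \<nu> \<in> Basis"
      using axis by (auto simp: signed_axis_def)
    from *[OF this] show ?thesis
      unfolding hyperplane_lborel_minus
      by (subst lborel_integral_real_affine[of "-1" _ 0]) (auto)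
  qed (use * in auto)
qed

text \<open>A ball in the hyperplane, thickened by a unit length along \<open>\<nu>\<close>, fits into a ball of the whole space.\<close>

lemma emeasure_hyperplane_lborel_cball:
  assumes axis: "signed_axis (\<nu>::'a::euclidean_space)"
  shows "emeasure (hyperplane_lborel \<nu>) (cball 0 r) < \<infinity>"
proof -
  have n: "norm \<nu> = 1"
    using signed_axis_norm[OF axis] by (simp add: norm_eq_1)
  have "emeasure (hyperplane_lborel \<nu>) (cball 0 r) = (\<integral>\<^sup>+y. indicator (cball 0 r) y \<partial>hyperplane_lborel \<nu>)"
    by simp
  \<comment> \<open>The points \<open>y + s *\<^sub>R \<nu>\<close> with \<open>\<bar>y\<bar> \<le> r\<close> and \<open>0 \<le> s \<le> 1\<close> lie in the ball of radius \<open>r + 1\<close>.\<close>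
  also have "\<dots> \<le> (\<integral>\<^sup>+y. (\<integral>\<^sup>+s. indicator (cball 0 (r + 1)) (y + s *\<^sub>R \<nu>) \<partial>lborel) \<partial>hyperplane_lborel \<nu>)"
  proof (intro nn_integral_mono)
    fix y :: 'a
    have "indicator (cball 0 r) y = (\<integral>\<^sup>+s. indicator (cball 0 r) y * indicator {0..1::real} s \<partial>lborel)"
      by (subst nn_integral_cmult_indicator) auto
    also have "\<dots> \<le> (\<integral>\<^sup>+s. indicator (cball 0 (r + 1)) (y + s *\<^sub>R \<nu>) \<partial>lborel)"
    proof (intro nn_integral_mono)
      fix s :: real
      have "norm (y + s *\<^sub>R \<nu>) \<le> r + 1" if "norm y \<le> r" "0 \<le> s" "s \<le> 1"
        using norm_triangle_ineq[of y "s *\<^sub>R \<nu>"] that n by simp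
      then show "indicator (cball 0 r) y * indicator {0..1::real} s
          \<le> (indicator (cball 0 (r + 1)) (y + s *\<^sub>R \<nu>) :: ennreal)"
        by (auto simp: indicator_def)
    qed
    finally show "indicator (cball 0 r) y \<le>
      (\<integral>\<^sup>+s. indicator (cball 0 (r + 1)) (y + s *\<^sub>R \<nu>) \<partial>lborel)" .
  qed
  also have "\<dots> = (\<integral>\<^sup>+x. indicator (cball 0 (r + 1)) x \<partial>(lborel::'a measure))"
    by (subst nn_integral_lborel_lines[OF axis]) (auto intro: borel_measurable_indicator)
  also have "\<dots> < \<infinity>"
    using emeasure_bounded_finite[OF bounded_cball, of "0::'a" "r + 1"] by simp
  finally show ?thesis .
qed

lemma integrable_continuous_compact_support:
  fixes F :: "'a::euclidean_space \<Rightarrow> real"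
  assumes F: "continuous_on UNIV F" and K: "compact K" "\<And>x. x \<notin> K \<Longrightarrow> F x = 0"
    and A: "A \<in> sets borel"
  shows "integrable lborel (\<lambda>x. indicator A x * F x)"
proof -
  have "integrable lborel (\<lambda>x. indicator K x *\<^sub>R F x)"
    by (rule borel_integrable_compact[OF K(1)]) (rule continuous_on_subset[OF F], auto)
  also have "(\<lambda>x. indicator K x *\<^sub>R F x) = F"
    using K(2) by (auto simp: indicator_def fun_eq_iff)
  finally show ?thesis
    using integrable_mult_indicator[of A lborel F] A by simp
qed

lemma bounded_support_on_line:
  fixes \<phi> :: "'a::euclidean_space \<Rightarrow> real"
  assumes K: "compact K" "\<And>x. x \<notin> K \<Longrightarrow> \<phi> x = 0" and v: "v \<bullet> v = 1"
  obtains a where "a > 0" "\<And>s. \<bar>s\<bar> \<ge> a \<Longrightarrow> \<phi> (y + s *\<^sub>R v) = 0"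
proof -
  obtain B where B: "\<And>x. x \<in> K \<Longrightarrow> norm x \<le> B"
    using compact_imp_bounded[OF K(1)] by (auto simp: bounded_iff)
  show thesis
  proof
    show "\<bar>B\<bar> + norm y + 1 > 0"
      using norm_ge_zero[of y] by linarith
    fix s assume s: "\<bar>s\<bar> \<ge> \<bar>B\<bar> + norm y + 1"
    have "norm (s *\<^sub>R v) = \<bar>s\<bar>"
      using v by (simp add: norm_eq_1)
    moreover have "norm (s *\<^sub>R v) \<le> norm (y + s *\<^sub>R v) + norm y"
      using norm_triangle_ineq4[of "y + s *\<^sub>R v" y] by simp
    ultimately have "norm (y + s *\<^sub>R v) > B"
      using s by linarith
    then show "\<phi> (y + s *\<^sub>R v) = 0"
      using B K(2) by force
  qed
qed

text \<open>The weight \<open>J\<close> is constant on each line parallel to \<open>e\<close>, so on that line the integral is the total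
  increment of a function of compact support.\<close>

lemma integral_derivative_along_axis_eq_0:
  fixes \<phi> J :: "'a::euclidean_space \<Rightarrow> real"
  assumes axis: "signed_axis e" and \<phi>: "C1_with_grad \<phi> G"
    and K: "compact K" "\<And>x. x \<notin> K \<Longrightarrow> \<phi> x = 0"
    and J: "\<And>x r. J (x + r *\<^sub>R e) = J x"
    and int: "integrable lborel (\<lambda>x. J x * (G x \<bullet> e))"
  shows "(\<integral>x. J x * (G x \<bullet> e) \<partial>lborel) = 0"
proof -
  have "(\<integral>s. G (y + s *\<^sub>R e) \<bullet> e \<partial>lborel) = 0" for y
  proof -
    obtain a where a: "a > 0" "\<And>s. \<bar>s\<bar> \<ge> a \<Longrightarrow> \<phi> (y + s *\<^sub>R e) = 0"
      by (rule bounded_support_on_line[where y = y, OF K signed_axis_norm[OF axis]]) auto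
    obtain a' where a': "a' > 0" "\<And>s. \<bar>s\<bar> \<ge> a' \<Longrightarrow> G (y + s *\<^sub>R e) \<bullet> e = 0"
      by (rule bounded_support_on_line[where y = y and \<phi> = "\<lambda>x. G x \<bullet> e", OF K(1) _ signed_axis_norm[OF axis]])
         (auto simp: C1_with_grad_zero_outside[OF \<phi> K])
    \<comment> \<open>Beyond distance \<open>c\<close> on the line both the function and its derivative vanish.\<close>
    define c where "c = max a a'"
    have "(\<integral>s. G (y + s *\<^sub>R e) \<bullet> e \<partial>lborel) =
        (\<integral>s. G (y + s *\<^sub>R e) \<bullet> e * indicator {- c..c} s \<partial>lborel)"
      by (intro Bochner_Integration.integral_cong) (auto simp: indicator_def c_def intro!: a'(2))
    also have "\<dots> = \<phi> (y + c *\<^sub>R e) - \<phi> (y + (- c) *\<^sub>R e)"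
      using a(1) by (intro integral_FTC_Icc_real[where F = "\<lambda>s. \<phi> (y + s *\<^sub>R e)"])
        (simp_all add: c_def C1_with_grad_line[OF \<phi>] isCont_grad_line[OF \<phi>])
    also have "\<dots> = 0"
      using a(1) a(2)[of c] a(2)[of "- c"] by (simp add: c_def)
    finally show ?thesis .
  qed
  then show ?thesis
    by (subst integral_lborel_lines[OF axis int]) (simp add: J)
qed

text \<open>On each line parallel to \<open>\<nu>\<close> the fundamental theorem of calculus leaves the value at the point where
  the line crosses the boundary hyperplane.\<close>

lemma integral_normal_derivative_halfspace:
  fixes \<phi> c :: "'a::euclidean_space \<Rightarrow> real"
  assumes axis: "signed_axis \<nu>" and \<phi>: "C1_with_grad \<phi> G"
    and K: "compact K" "\<And>x. x \<notin> K \<Longrightarrow> \<phi> x = 0"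
    and c: "\<And>x r. c (x + r *\<^sub>R \<nu>) = c x"
    and int: "integrable lborel (\<lambda>x. indicator {x. x \<bullet> \<nu> < 0} x * (c x * (G x \<bullet> \<nu>)))"
    and [measurable]: "c \<in> borel_measurable borel"
  shows "(\<integral>x. indicator {x. x \<bullet> \<nu> < 0} x * (c x * (G x \<bullet> \<nu>)) \<partial>lborel) =
    (\<integral>y. c y * \<phi> y \<partial>hyperplane_lborel \<nu>)"
proof -
  note [measurable] = C1_with_grad_measurable[OF \<phi>]
  have line: "(\<integral>s. indicator {..<0} s * (G (y + s *\<^sub>R \<nu>) \<bullet> \<nu>) \<partial>lborel) = \<phi> y" for y
  proof -
    obtain a where a: "a > 0" "\<And>s. \<bar>s\<bar> \<ge> a \<Longrightarrow> \<phi> (y + s *\<^sub>R \<nu>) = 0"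
      by (rule bounded_support_on_line[where y = y, OF K signed_axis_norm[OF axis]]) auto
    obtain a' where a': "a' > 0" "\<And>s. \<bar>s\<bar> \<ge> a' \<Longrightarrow> G (y + s *\<^sub>R \<nu>) \<bullet> \<nu> = 0"
      by (rule bounded_support_on_line[where y = y and \<phi> = "\<lambda>x. G x \<bullet> \<nu>", OF K(1) _ signed_axis_norm[OF axis]])
         (auto simp: C1_with_grad_zero_outside[OF \<phi> K])
    define c where "c = max a a'"
    have "AE s in lborel. s \<noteq> (0::real)"
      by (rule AE_lborel_singleton)
    then have "(\<integral>s. indicator {..<0} s * (G (y + s *\<^sub>R \<nu>) \<bullet> \<nu>) \<partial>lborel) =
        (\<integral>s. G (y + s *\<^sub>R \<nu>) \<bullet> \<nu> * indicator {- c..0} s \<partial>lborel)"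
      by (intro integral_cong_AE, measurable) (auto simp: indicator_def c_def intro!: a'(2))
    also have "\<dots> = \<phi> (y + 0 *\<^sub>R \<nu>) - \<phi> (y + (- c) *\<^sub>R \<nu>)"
      using a(1) by (intro integral_FTC_Icc_real[where F = "\<lambda>s. \<phi> (y + s *\<^sub>R \<nu>)"])
        (simp_all add: c_def C1_with_grad_line[OF \<phi>] isCont_grad_line[OF \<phi>])
    also have "\<dots> = \<phi> y"
      using a(1) a(2)[of c] a(2)[of "- c"] by (simp add: c_def)
    finally show ?thesis .
  qed
  have "(\<integral>x. indicator {x. x \<bullet> \<nu> < 0} x * (c x * (G x \<bullet> \<nu>)) \<partial>lborel) =
     (\<integral>y. (\<integral>s. indicator {x. x \<bullet> \<nu> < 0} (y + s *\<^sub>R \<nu>) * (c y * (G (y + s *\<^sub>R \<nu>) \<bullet> \<nu>)) \<partial>lborel)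
        \<partial>hyperplane_lborel \<nu>)"
    by (subst integral_lborel_lines[OF axis int]) (simp add: c)
  also have "\<dots> = (\<integral>y. c y * \<phi> y \<partial>hyperplane_lborel \<nu>)"
  proof (intro integral_cong_AE)
    show "AE y in hyperplane_lborel \<nu>.
      (\<integral>s. indicator {x. x \<bullet> \<nu> < 0} (y + s *\<^sub>R \<nu>) * (c y * (G (y + s *\<^sub>R \<nu>) \<bullet> \<nu>)) \<partial>lborel) = c y * \<phi> y"
      using AE_hyperplane_lborel_orthogonal[OF axis]
    proof eventually_elim
      case (elim y)
      have "(\<integral>s. indicator {x. x \<bullet> \<nu> < 0} (y + s *\<^sub>R \<nu>) * (c y * (G (y + s *\<^sub>R \<nu>) \<bullet> \<nu>)) \<partial>lborel)
        = (\<integral>s. c y * (indicator {..<0} s * (G (y + s *\<^sub>R \<nu>) \<bullet> \<nu>)) \<partial>lborel)"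
        using elim signed_axis_norm[OF axis]
        by (intro Bochner_Integration.integral_cong) (auto simp: indicator_def inner_add_left)
      then show ?case
        by (simp add: line)
    qed
  qed auto
  finally show ?thesis .
qed

section \<open>The divergence theorem for a subgraph\<close>

text \<open>On each line parallel to \<open>\<nu>\<close> the shear is a translation, because \<open>h\<close> is constant on that line.\<close>

lemma distr_lborel_shear:
  fixes h :: "'a::euclidean_space \<Rightarrow> real"
  assumes axis: "signed_axis \<nu>" and h[measurable]: "h \<in> borel_measurable borel"
    and inv: "\<And>x r. h (x + r *\<^sub>R \<nu>) = h x"
  shows "distr lborel borel (\<lambda>x. x + h x *\<^sub>R \<nu>) = lborel"
proof (rule measure_eqI)
  fix A assume "A \<in> sets (distr lborel borel (\<lambda>x. x + h x *\<^sub>R \<nu>))"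
  then have A[measurable]: "A \<in> sets borel"
    by simp
  have "emeasure (distr lborel borel (\<lambda>x. x + h x *\<^sub>R \<nu>)) A =
      (\<integral>\<^sup>+x. indicator A x \<partial>distr lborel borel (\<lambda>x. x + h x *\<^sub>R \<nu>))"
    by simp
  also have "\<dots> = (\<integral>\<^sup>+x. indicator A (x + h x *\<^sub>R \<nu>) \<partial>lborel)"
    by (rule nn_integral_distr) auto
  also have "\<dots> = (\<integral>\<^sup>+y. (\<integral>\<^sup>+s. indicator A (y + (h y + 1 * s) *\<^sub>R \<nu>) \<partial>lborel) \<partial>hyperplane_lborel \<nu>)"
    by (subst nn_integral_lborel_lines[OF axis]) (auto simp: inv algebra_simps)
  also have "\<dots> = (\<integral>\<^sup>+y. (\<integral>\<^sup>+s. indicator A (y + s *\<^sub>R \<nu>) \<partial>lborel) \<partial>hyperplane_lborel \<nu>)"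
  proof (rule nn_integral_cong)
    fix y
    show "(\<integral>\<^sup>+s. indicator A (y + (h y + 1 * s) *\<^sub>R \<nu>) \<partial>lborel) =
        (\<integral>\<^sup>+s. indicator A (y + s *\<^sub>R \<nu>) \<partial>lborel)"
      using nn_integral_real_affine[of "\<lambda>s. indicator A (y + s *\<^sub>R \<nu>)" 1 "h y"] by simp
  qed
  also have "\<dots> = emeasure lborel A"
    by (subst nn_integral_lborel_lines[OF axis, symmetric]) auto
  finally show "emeasure (distr lborel borel (\<lambda>x. x + h x *\<^sub>R \<nu>)) A = emeasure lborel A" .
qed auto

lemma C1_with_grad_shear:
  assumes h: "C1_with_grad h g" and \<phi>: "C1_with_grad \<phi> G"
  shows "C1_with_grad (\<lambda>z. \<phi> (z + h z *\<^sub>R \<nu>))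
    (\<lambda>z. G (z + h z *\<^sub>R \<nu>) + (G (z + h z *\<^sub>R \<nu>) \<bullet> \<nu>) *\<^sub>R g z)"
  unfolding C1_with_grad_def
proof
  show "\<forall>z. GDERIV (\<lambda>z. \<phi> (z + h z *\<^sub>R \<nu>)) z :> G (z + h z *\<^sub>R \<nu>) + (G (z + h z *\<^sub>R \<nu>) \<bullet> \<nu>) *\<^sub>R g z"
  proof
    fix z
    have hd: "(h has_derivative (\<lambda>t. t \<bullet> g z)) (at z)"
      using h by (auto simp: C1_with_grad_def gderiv_def)
    have "((\<lambda>z. \<phi> (z + h z *\<^sub>R \<nu>)) has_derivative
        (\<lambda>t. (t + (t \<bullet> g z) *\<^sub>R \<nu>) \<bullet> G (z + h z *\<^sub>R \<nu>))) (at z)"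
      using \<phi> unfolding C1_with_grad_def gderiv_def
      by (intro has_derivative_compose[of "\<lambda>z. z + h z *\<^sub>R \<nu>" "\<lambda>t. t + (t \<bullet> g z) *\<^sub>R \<nu>" _ _ \<phi>])
         (auto intro!: derivative_eq_intros hd)
    then show "GDERIV (\<lambda>z. \<phi> (z + h z *\<^sub>R \<nu>)) z :> G (z + h z *\<^sub>R \<nu>) + (G (z + h z *\<^sub>R \<nu>) \<bullet> \<nu>) *\<^sub>R g z"
      unfolding gderiv_def by (simp add: inner_add_left inner_add_right inner_commute mult.commute)
  qed
  have S: "continuous_on UNIV (\<lambda>z. z + h z *\<^sub>R \<nu>)"
    by (intro continuous_intros C1_with_grad_continuous[OF h])
  have "continuous_on UNIV (\<lambda>z. G (z + h z *\<^sub>R \<nu>))"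
    by (rule continuous_on_compose2[OF C1_with_grad_continuous(2)[OF \<phi>, of UNIV] S]) auto
  then show "continuous_on UNIV (\<lambda>z. G (z + h z *\<^sub>R \<nu>) + (G (z + h z *\<^sub>R \<nu>) \<bullet> \<nu>) *\<^sub>R g z)"
    by (intro continuous_intros C1_with_grad_continuous[OF h])
qed

text \<open>The shear \<open>z \<mapsto> z + h z *\<^sub>R \<nu>\<close> preserves volume and maps a half-space onto the subgraph. After this
  substitution the derivative splits into a part tangential to the flat boundary, which integrates to
  \<open>0\<close>, and a part along \<open>\<nu>\<close>, which integrates to boundary values. The vector \<open>\<nu> - g y\<close> is the outward
  normal multiplied by the area element.\<close>

lemma divergence_subgraph:
  fixes \<phi> h :: "'a::euclidean_space \<Rightarrow> real"
  assumes axis: "signed_axis \<nu>" and h: "C1_with_grad h g" and inv: "\<And>x r. h (x + r *\<^sub>R \<nu>) = h x"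
    and \<phi>: "C1_with_grad \<phi> G" and K: "compact K" "\<And>x. x \<notin> K \<Longrightarrow> \<phi> x = 0"
    and e: "e \<in> Basis"
  shows "(\<integral>x. indicator {x. x \<bullet> \<nu> < h x} x * (G x \<bullet> e) \<partial>lborel) =
     (\<integral>y. ((\<nu> - g y) \<bullet> e) * \<phi> (y + h y *\<^sub>R \<nu>) \<partial>hyperplane_lborel \<nu>)"
proof -
  note [measurable] = C1_with_grad_measurable[OF \<phi>] C1_with_grad_measurable[OF h]
  define S where "S z = z + h z *\<^sub>R \<nu>" for z
  define \<psi> where "\<psi> z = \<phi> (S z)" for z
  define H where "H z = G (S z) + (G (S z) \<bullet> \<nu>) *\<^sub>R g z" for z
  define N where "N = {z. z \<bullet> \<nu> < 0}"
  define K' where "K' = (\<lambda>x. x - h x *\<^sub>R \<nu>) ` K"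
  have N[measurable]: "N \<in> sets borel"
    unfolding N_def by measurable
  have [measurable]: "S \<in> borel_measurable borel"
    unfolding S_def by measurable
  have \<psi>: "C1_with_grad \<psi> H"
    unfolding \<psi>_def H_def S_def by (rule C1_with_grad_shear[OF h \<phi>])
  have nn: "\<nu> \<bullet> \<nu> = 1"
    by (rule signed_axis_norm[OF axis])
  have g\<nu>: "g x \<bullet> \<nu> = 0" "g (x + r *\<^sub>R \<nu>) = g x" for x r
    using C1_with_grad_orthogonal[OF h inv] by auto
  have \<psi>0: "\<psi> z = 0" if "z \<notin> K'" for z
  proof -
    have "S z \<notin> K"
    proof
      assume "S z \<in> K"
      moreover have "z = S z - h (S z) *\<^sub>R \<nu>"
        by (simp add: S_def inv)
      ultimately show False
        using that unfolding K'_def by blast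
    qed
    then show "\<psi> z = 0"
      using K(2) by (simp add: \<psi>_def)
  qed
  have cK': "compact K'"
    unfolding K'_def
    by (intro compact_continuous_image K continuous_intros C1_with_grad_continuous[OF h])
  have H0: "H z = 0" if "z \<notin> K'" for z
    using C1_with_grad_zero_outside[OF \<psi> cK' \<psi>0 that] .
  have int: "integrable lborel (\<lambda>z. indicator N z * (H z \<bullet> v))" for v
    by (rule integrable_continuous_compact_support[OF _ cK'])
       (auto intro!: continuous_intros C1_with_grad_continuous[OF \<psi>] simp: H0)
  have int_c: "integrable lborel (\<lambda>z. indicator N z * (((\<nu> - g z) \<bullet> e) * (H z \<bullet> \<nu>)))"
    by (rule integrable_continuous_compact_support[OF _ cK'])
       (auto intro!: continuous_intros C1_with_grad_continuous[OF \<psi>] C1_with_grad_continuous[OF h]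
          simp: H0)
  have "(\<integral>x. indicator {x. x \<bullet> \<nu> < h x} x * (G x \<bullet> e) \<partial>lborel) =
      (\<integral>x. indicator {x. x \<bullet> \<nu> < h x} x * (G x \<bullet> e) \<partial>distr lborel borel S)"
    unfolding S_def by (subst distr_lborel_shear[OF axis _ inv]) auto
  also have "\<dots> = (\<integral>z. indicator {x. x \<bullet> \<nu> < h x} (S z) * (G (S z) \<bullet> e) \<partial>lborel)"
    by (rule integral_distr) auto
  \<comment> \<open>By the chain rule \<open>G (S z) \<bullet> e = H z \<bullet> e - (g z \<bullet> e) * (H z \<bullet> \<nu>)\<close>; the component of \<open>e\<close> along \<open>\<nu>\<close> is moved
    to the second summand, which then carries all of the derivative across the flat boundary.\<close>
  also have "\<dots> = (\<integral>z. indicator N z * (H z \<bullet> (e - (\<nu> \<bullet> e) *\<^sub>R \<nu>))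
      + indicator N z * (((\<nu> - g z) \<bullet> e) * (H z \<bullet> \<nu>)) \<partial>lborel)"
  proof (rule Bochner_Integration.integral_cong[OF refl])
    fix z
    have "indicator {x. x \<bullet> \<nu> < h x} (S z) = (indicator N z :: real)"
      by (auto simp: indicator_def N_def S_def inner_add_left nn inv)
    moreover have "H z \<bullet> \<nu> = G (S z) \<bullet> \<nu>"
      by (simp add: H_def inner_add_left g\<nu>)
    moreover have "H z \<bullet> e = G (S z) \<bullet> e + (G (S z) \<bullet> \<nu>) * (g z \<bullet> e)"
      by (simp add: H_def inner_add_left)
    ultimately show "indicator {x. x \<bullet> \<nu> < h x} (S z) * (G (S z) \<bullet> e) =
        indicator N z * (H z \<bullet> (e - (\<nu> \<bullet> e) *\<^sub>R \<nu>)) + indicator N z * (((\<nu> - g z) \<bullet> e) * (H z \<bullet> \<nu>))"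
      by (simp add: inner_diff_right inner_diff_left algebra_simps)
  qed
  also have "\<dots> = (\<integral>z. indicator N z * (H z \<bullet> (e - (\<nu> \<bullet> e) *\<^sub>R \<nu>)) \<partial>lborel)
      + (\<integral>z. indicator N z * (((\<nu> - g z) \<bullet> e) * (H z \<bullet> \<nu>)) \<partial>lborel)"
    by (rule Bochner_Integration.integral_add[OF int int_c])
  \<comment> \<open>The tangential part: the half-space is invariant under translation along \<open>e\<close>.\<close>
  also have "(\<integral>z. indicator N z * (H z \<bullet> (e - (\<nu> \<bullet> e) *\<^sub>R \<nu>)) \<partial>lborel) = 0"
  proof (cases "\<nu> \<bullet> e = 0")
    case True
    have "(\<integral>z. indicator N z * (H z \<bullet> e) \<partial>lborel) = 0"
      by (rule integral_derivative_along_axis_eq_0[OF _ \<psi> cK' \<psi>0])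
         (use e True int in \<open>auto simp: signed_axis_def N_def indicator_def inner_add_left inner_add_right inner_commute\<close>)
    then show ?thesis
      by (simp add: True)
  next
    case False
    then have "\<nu> = e \<or> \<nu> = - e"
      using axis e unfolding signed_axis_def
      by (metis inner_minus_left inner_not_same_Basis minus_minus neg_equal_0_iff_equal)
    then have "e - (\<nu> \<bullet> e) *\<^sub>R \<nu> = 0"
      using e by (auto simp: inner_same_Basis)
    then show ?thesis
      by simp
  qed
  also have "(\<integral>z. indicator N z * (((\<nu> - g z) \<bullet> e) * (H z \<bullet> \<nu>)) \<partial>lborel) =
      (\<integral>y. ((\<nu> - g y) \<bullet> e) * \<psi> y \<partial>hyperplane_lborel \<nu>)"
    unfolding N_def
    by (rule integral_normal_derivative_halfspace[OF axis \<psi> cK' \<psi>0])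
       (use int_c in \<open>auto simp: g\<nu> N_def\<close>)
  finally show ?thesis
    by (simp add: \<psi>_def S_def)
qed

section \<open>Outward normal and surface measure\<close>

lemma graph_chartD:
  assumes "graph_chart \<Omega> U \<nu> h g"
  shows "open U" "signed_axis \<nu>" "C1_with_grad h g" "\<And>x r. h (x + r *\<^sub>R \<nu>) = h x"
    "\<And>x. x \<in> U \<Longrightarrow> x \<in> \<Omega> \<longleftrightarrow> x \<bullet> \<nu> < h x"
  using assms by (auto simp: graph_chart_def signed_axis_def)

lemma graph_chart_orthogonal:
  assumes "graph_chart \<Omega> U \<nu> h g"
  shows "g x \<bullet> \<nu> = 0" "g (x + r *\<^sub>R \<nu>) = g x"
  using C1_with_grad_orthogonal[OF graph_chartD(3,4)[OF assms]] by auto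

text \<open>Downward along \<open>\<nu>\<close> from a point of the graph one enters \<open>\<Omega>\<close>; strictly above the graph one stays away
  from \<open>\<Omega>\<close>.\<close>

lemma frontier_in_chart:
  fixes \<Omega> :: "'a::euclidean_space set"
  assumes chart: "graph_chart \<Omega> U \<nu> h g" and "open \<Omega>" and p: "p \<in> U"
  shows "p \<in> frontier \<Omega> \<longleftrightarrow> p \<bullet> \<nu> = h p"
proof -
  note ch = graph_chartD[OF chart]
  have front: "p \<in> frontier \<Omega> \<longleftrightarrow> p \<in> closure \<Omega> \<and> p \<notin> \<Omega>"
    using \<open>open \<Omega>\<close> by (auto simp: frontier_def interior_open)
  have c: "continuous_on UNIV (\<lambda>x. x \<bullet> \<nu> - h x)"
    by (intro continuous_intros C1_with_grad_continuous[OF ch(3)])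
  show ?thesis
  proof
    assume "p \<in> frontier \<Omega>"
    then have cl: "p \<in> closure \<Omega>" and n: "\<not> p \<bullet> \<nu> < h p"
      using front ch(5)[OF p] by auto
    show "p \<bullet> \<nu> = h p"
    proof (rule ccontr)
      assume "p \<bullet> \<nu> \<noteq> h p"
      then have "p \<in> U \<inter> {x. 0 < x \<bullet> \<nu> - h x}"
        using n p by auto
      moreover have "open (U \<inter> {x. 0 < x \<bullet> \<nu> - h x})"
        by (intro open_Int ch open_Collect_less c continuous_intros)
      ultimately obtain q where "q \<in> \<Omega>" "q \<in> U \<inter> {x. 0 < x \<bullet> \<nu> - h x}"
        using cl unfolding closure_iff_nhds_not_empty by blast
      then show False
        using ch(5)[of q] by auto
    qed
  next
    assume eq: "p \<bullet> \<nu> = h p"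
    have "p \<in> closure \<Omega>"
      unfolding closure_approachable
    proof (intro allI impI)
      fix e :: real assume "e > 0"
      obtain d where d: "d > 0" "ball p d \<subseteq> U"
        using ch(1) p by (meson openE)
      define s where "s = min d e / 2"
      have s: "s > 0" "s < d" "s < e"
        using d \<open>e > 0\<close> by (auto simp: s_def min_def)
      have nn: "norm \<nu> = 1" "\<nu> \<bullet> \<nu> = 1"
        using signed_axis_norm[OF ch(2)] by (auto simp: norm_eq_1)
      have "p + (- s) *\<^sub>R \<nu> \<in> U"
        using d s nn by (auto simp: dist_norm)
      moreover have "(p + (- s) *\<^sub>R \<nu>) \<bullet> \<nu> < h (p + (- s) *\<^sub>R \<nu>)"
        unfolding ch(4) using eq s nn by (simp add: inner_diff_left)
      ultimately have "p + (- s) *\<^sub>R \<nu> \<in> \<Omega>"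
        using ch(5) by blast
      then show "\<exists>y\<in>\<Omega>. dist y p < e"
        by (rule bexI[rotated]) (use s nn in \<open>auto simp: dist_norm\<close>)
    qed
    then show "p \<in> frontier \<Omega>"
      using front ch(5)[OF p] eq by simp
  qed
qed

lemma norm_normal_of_chart:
  assumes chart: "graph_chart \<Omega> U \<nu> h g"
  shows "norm (\<nu> - g p) = sqrt (1 + (norm (g p))\<^sup>2)"
  using graph_chart_orthogonal(1)[OF chart, of p] signed_axis_norm[OF graph_chartD(2)[OF chart]]
  by (simp add: norm_eq_sqrt_inner inner_diff_left inner_diff_right inner_commute)

lemma sqrt_1_plus_sq_pos: "sqrt (1 + x\<^sup>2) > 0" "sqrt (1 + x\<^sup>2) \<ge> 1"
  by (auto simp: add_pos_nonneg)

lemma unit_vectors_diff_inner: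
  fixes m n :: "'a::real_inner"
  assumes "norm m = 1" "norm n = 1" "m \<noteq> n"
  shows "(m - n) \<bullet> n < 0" "(m - n) \<bullet> m > 0"
proof -
  have mm: "m \<bullet> m = 1" "n \<bullet> n = 1"
    using assms by (metis norm_eq_1)+
  have "0 < (m - n) \<bullet> (m - n)"
    using assms(3) by simp
  then have "m \<bullet> n < 1"
    using mm by (simp add: inner_diff_left inner_diff_right inner_commute)
  then show "(m - n) \<bullet> n < 0" "(m - n) \<bullet> m > 0"
    using mm by (simp_all add: inner_diff_left inner_diff_right inner_commute)
qed

lemma outward_unit_normal_chart:
  fixes \<Omega> :: "'a::euclidean_space set"
  assumes chart: "graph_chart \<Omega> U \<nu> h g" and "open \<Omega>" and p: "p \<in> U" "p \<in> frontier \<Omega>"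
  shows "outward_unit_normal \<Omega> p = (\<nu> - g p) /\<^sub>R sqrt (1 + (norm (g p))\<^sup>2)"
    (is "_ = ?n")
proof -
  note ch = graph_chartD[OF chart]
  let ?in = "\<lambda>n. \<forall>v. v \<bullet> n < 0 \<longrightarrow> (\<forall>\<^sub>F r in at_right 0. p + r *\<^sub>R v \<in> \<Omega>)"
  let ?out = "\<lambda>n. \<forall>v. v \<bullet> n > 0 \<longrightarrow> (\<forall>\<^sub>F r in at_right 0. p + r *\<^sub>R v \<notin> \<Omega>)"
  have p0: "p \<bullet> \<nu> = h p"
    using frontier_in_chart[OF chart \<open>open \<Omega>\<close> p(1)] p(2) by simp
  note pos = sqrt_1_plus_sq_pos(1)[of "norm (g p)"]
  have inU: "\<forall>\<^sub>F r in at_right 0. p + r *\<^sub>R v \<in> U" for v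
  proof -
    have "((\<lambda>r. p + r *\<^sub>R v) \<longlongrightarrow> p + 0 *\<^sub>R v) (at_right 0)"
      by (intro tendsto_intros)
    then show ?thesis
      using topological_tendstoD[OF _ ch(1)] p(1) by fastforce
  qed
  have der: "((\<lambda>r. (p + r *\<^sub>R v) \<bullet> \<nu> - h (p + r *\<^sub>R v)) has_real_derivative v \<bullet> (\<nu> - g p)) (at 0)" for v
  proof -
    have "((\<lambda>r. h (p + r *\<^sub>R v)) has_real_derivative g (p + 0 *\<^sub>R v) \<bullet> v) (at 0)"
      by (rule C1_with_grad_line[OF ch(3)])
    then have "((\<lambda>r. p \<bullet> \<nu> + r * (v \<bullet> \<nu>) - h (p + r *\<^sub>R v)) has_real_derivative v \<bullet> (\<nu> - g p)) (at 0)"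
      by (auto intro!: derivative_eq_intros simp: inner_diff_right inner_commute)
    then show ?thesis
      by (simp add: inner_add_left)
  qed
  \<comment> \<open>Along a ray from \<open>p\<close> the defining function \<open>x \<bullet> \<nu> - h x\<close> vanishes at the start and has slope
    \<open>v \<bullet> (\<nu> - g p)\<close> there, so the sign of the slope decides on which side the ray starts.\<close>
  have n_in: "?in ?n"
  proof (intro allI impI)
    fix v assume "v \<bullet> ?n < 0"
    then have "v \<bullet> (\<nu> - g p) < 0"
      using pos by (simp add: divide_less_0_iff zero_less_mult_iff mult_less_0_iff)
    from DERIV_neg_dec_right[OF der this] have
      "\<forall>\<^sub>F r in at_right 0. (p + r *\<^sub>R v) \<bullet> \<nu> - h (p + r *\<^sub>R v) < 0"
      by (auto simp: eventually_at_right_field p0)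
    with inU[of v] show "\<forall>\<^sub>F r in at_right 0. p + r *\<^sub>R v \<in> \<Omega>"
      by eventually_elim (simp add: ch(5))
  qed
  have n_out: "?out ?n"
  proof (intro allI impI)
    fix v assume "v \<bullet> ?n > 0"
    then have "v \<bullet> (\<nu> - g p) > 0"
      using pos by (simp add: zero_less_divide_iff zero_less_mult_iff)
    from DERIV_pos_inc_right[OF der this] have
      "\<forall>\<^sub>F r in at_right 0. (p + r *\<^sub>R v) \<bullet> \<nu> - h (p + r *\<^sub>R v) > 0"
      by (auto simp: eventually_at_right_field p0)
    with inU[of v] show "\<forall>\<^sub>F r in at_right 0. p + r *\<^sub>R v \<notin> \<Omega>"
      by eventually_elim (simp add: ch(5))
  qed
  have n1: "norm ?n = 1"
    using norm_normal_of_chart[OF chart, of p] pos by simp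
  show ?thesis
    unfolding outward_unit_normal_def
  proof (rule the_equality)
    show "norm ?n = 1 \<and> ?in ?n \<and> ?out ?n"
      using n1 n_in n_out by blast
    fix m assume m: "norm m = 1 \<and> ?in m \<and> ?out m"
    show "m = ?n"
    proof (rule ccontr)
      assume "m \<noteq> ?n"
      \<comment> \<open>A second such vector would force the direction \<open>m - ?n\<close> both into and out of the domain.\<close>
      have "(m - ?n) \<bullet> ?n < 0" "(m - ?n) \<bullet> m > 0"
        using unit_vectors_diff_inner[OF _ n1 \<open>m \<noteq> ?n\<close>] m by blast+
      then have "\<forall>\<^sub>F r in at_right (0::real). p + r *\<^sub>R (m - ?n) \<in> \<Omega>"
        "\<forall>\<^sub>F r in at_right (0::real). p + r *\<^sub>R (m - ?n) \<notin> \<Omega>"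
        using m n_in by blast+
      then have "\<forall>\<^sub>F r in at_right (0::real). False"
        by eventually_elim simp
      then show False
        by simp
    qed
  qed
qed

text \<open>Off the boundary the description of the outward normal has no meaning. Extending it by \<open>0\<close> gives a
  Borel function on the whole space, on which the surface measure lives.\<close>

definition boundary_normal :: "'a::euclidean_space set \<Rightarrow> 'a \<Rightarrow> 'a" where
  "boundary_normal \<Omega> x = indicator (frontier \<Omega>) x *\<^sub>R outward_unit_normal \<Omega> x"

text \<open>Near each boundary point the normal agrees on the boundary with the continuous expression of a chart.\<close>

lemma continuous_on_outward_unit_normal:
  fixes \<Omega> :: "'a::euclidean_space set"
  assumes "bounded_smooth_domain \<Omega>"
  shows "continuous_on (frontier \<Omega>) (outward_unit_normal \<Omega>)"
  unfolding continuous_on_def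
proof
  fix p assume p: "p \<in> frontier \<Omega>"
  obtain U \<nu> h g where U: "p \<in> U" and chart: "graph_chart \<Omega> U \<nu> h g"
    using assms p unfolding bounded_smooth_domain_def by blast
  have op: "open \<Omega>"
    using assms by (simp add: bounded_smooth_domain_def)
  let ?n = "\<lambda>p. (\<nu> - g p) /\<^sub>R sqrt (1 + (norm (g p))\<^sup>2)"
  have "continuous_on UNIV ?n"
    using sqrt_1_plus_sq_pos
    by (intro continuous_intros C1_with_grad_continuous[OF graph_chartD(3)[OF chart]])
       (auto simp: less_imp_neq[THEN not_sym])
  then have "(?n \<longlongrightarrow> ?n p) (at p within frontier \<Omega>)"
    using continuous_on_subset[of UNIV ?n "frontier \<Omega>"] p by (auto simp: continuous_on_def)
  moreover have "\<forall>\<^sub>F x in at p within frontier \<Omega>. ?n x = outward_unit_normal \<Omega> x"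
    unfolding eventually_at_topological
    using graph_chartD(1)[OF chart] U outward_unit_normal_chart[OF chart op] by auto
  ultimately show "(outward_unit_normal \<Omega> \<longlongrightarrow> outward_unit_normal \<Omega> p) (at p within frontier \<Omega>)"
    unfolding outward_unit_normal_chart[OF chart op U p] by (rule Lim_transform_eventually)
qed

lemma boundary_normal_measurable [measurable]:
  assumes "bounded_smooth_domain \<Omega>"
  shows "boundary_normal \<Omega> \<in> borel_measurable borel"
  unfolding boundary_normal_def
  by (intro borel_measurable_continuous_on_indicator continuous_on_outward_unit_normal assms) auto

lemma norm_boundary_normal_le:
  assumes "bounded_smooth_domain \<Omega>"
  shows "norm (boundary_normal \<Omega> x) \<le> 1"
proof (cases "x \<in> frontier \<Omega>")
  case True
  then obtain U \<nu> h g where U: "x \<in> U" and chart: "graph_chart \<Omega> U \<nu> h g"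
    using assms unfolding bounded_smooth_domain_def by blast
  have op: "open \<Omega>"
    using assms by (simp add: bounded_smooth_domain_def)
  show ?thesis
    using norm_normal_of_chart[OF chart, of x] sqrt_1_plus_sq_pos(1)[of "norm (g x)"] True
    by (simp add: boundary_normal_def outward_unit_normal_chart[OF chart op U True])
qed (simp add: boundary_normal_def)

lemma AE_frontier:
  assumes "is_surface_measure \<Omega> \<sigma>" shows "AE x in \<sigma>. x \<in> frontier \<Omega>"
  by (rule AE_I[where N = "- frontier \<Omega>"]) (use assms in \<open>auto simp: is_surface_measure_def\<close>)

text \<open>The defining property of the surface measure determines it on Borel subsets of a chart; here this is
  carried over from measures of sets to integrals.\<close>

lemma surface_integral_in_chart:
  fixes \<psi> :: "'a::euclidean_space \<Rightarrow> real"
  assumes \<sigma>: "is_surface_measure \<Omega> \<sigma>" and chart: "graph_chart \<Omega> U \<nu> h g"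
    and \<psi>[measurable]: "\<psi> \<in> borel_measurable borel"
    and supp: "\<And>x. x \<notin> frontier \<Omega> \<inter> U \<Longrightarrow> \<psi> x = 0"
  shows "(\<integral>x. \<psi> x \<partial>\<sigma>) =
    (\<integral>y. sqrt (1 + (norm (g y))\<^sup>2) * \<psi> (y + h y *\<^sub>R \<nu>) \<partial>hyperplane_lborel \<nu>)"
proof -
  note [measurable] = C1_with_grad_measurable[OF graph_chartD(3)[OF chart]]
  define B where "B = frontier \<Omega> \<inter> U"
  define S where "S y = y + h y *\<^sub>R \<nu>" for y
  have S[measurable]: "S \<in> borel_measurable borel"
    unfolding S_def by measurable
  have B[measurable]: "B \<in> sets borel"
    unfolding B_def using graph_chartD(1)[OF chart] by auto
  have s[measurable_cong]: "sets \<sigma> = sets borel"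
    using \<sigma> by (simp add: is_surface_measure_def)
  let ?D = "density (hyperplane_lborel \<nu>) (\<lambda>y. ennreal (sqrt (1 + (norm (g y))\<^sup>2) * indicator B (S y)))"
  \<comment> \<open>On \<open>B\<close> the surface measure is the image of a weighted hyperplane measure under the graph map.\<close>
  have eq: "density \<sigma> (\<lambda>x. ennreal (indicator B x)) = distr ?D borel S"
  proof (rule measure_eqI)
    fix A assume "A \<in> sets (density \<sigma> (\<lambda>x. ennreal (indicator B x)))"
    then have A[measurable]: "A \<in> sets borel"
      using s by simp
    have "emeasure (density \<sigma> (\<lambda>x. ennreal (indicator B x))) A =
        (\<integral>\<^sup>+x. ennreal (indicator B x) * indicator A x \<partial>\<sigma>)"
      by (rule emeasure_density) auto
    also have "\<dots> = (\<integral>\<^sup>+x. indicator (A \<inter> B) x \<partial>\<sigma>)"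
      by (rule nn_integral_cong) (auto simp: indicator_def)
    also have "\<dots> = emeasure \<sigma> (A \<inter> B)"
      by simp
    also have "\<dots> = (\<integral>\<^sup>+ y. ennreal (sqrt (1 + (norm (g y))\<^sup>2)) * indicator (A \<inter> B) (y + h y *\<^sub>R \<nu>)
             \<partial>hyperplane_lborel \<nu>)"
    proof -
      have "A \<inter> B \<in> sets borel" "A \<inter> B \<subseteq> frontier \<Omega> \<inter> U"
        using A B by (auto simp: B_def)
      then show ?thesis
        using \<sigma> chart unfolding is_surface_measure_def by blast
    qed
    also have "\<dots> = (\<integral>\<^sup>+ y. ennreal (sqrt (1 + (norm (g y))\<^sup>2) * indicator B (S y)) * indicator (S -` A) y
             \<partial>hyperplane_lborel \<nu>)"
      by (intro nn_integral_cong) (auto simp: S_def indicator_def)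
    also have "\<dots> = emeasure (distr ?D borel S) A"
      by (subst emeasure_distr, measurable)
         (subst emeasure_density, auto intro: measurable_sets_borel[OF S])
    finally show "emeasure (density \<sigma> (\<lambda>x. ennreal (indicator B x))) A = emeasure (distr ?D borel S) A" .
  qed (use s in simp)
  have "(\<integral>x. \<psi> x \<partial>\<sigma>) = (\<integral>x. indicator B x *\<^sub>R \<psi> x \<partial>\<sigma>)"
    by (intro Bochner_Integration.integral_cong) (auto simp: indicator_def B_def intro!: supp)
  also have "\<dots> = (\<integral>x. \<psi> x \<partial>distr ?D borel S)"
    unfolding eq[symmetric] by (subst integral_density) auto
  also have "\<dots> = (\<integral>y. \<psi> (S y) \<partial>?D)"
    by (rule integral_distr) auto
  also have "\<dots> = (\<integral>y. (sqrt (1 + (norm (g y))\<^sup>2) * indicator B (S y)) *\<^sub>R \<psi> (S y) \<partial>hyperplane_lborel \<nu>)"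
    by (subst integral_density) (auto simp: less_imp_le[OF sqrt_1_plus_sq_pos(1)])
  also have "\<dots> = (\<integral>y. sqrt (1 + (norm (g y))\<^sup>2) * \<psi> (S y) \<partial>hyperplane_lborel \<nu>)"
  proof (rule Bochner_Integration.integral_cong[OF refl])
    fix y
    show "(sqrt (1 + (norm (g y))\<^sup>2) * indicator B (S y)) *\<^sub>R \<psi> (S y) = sqrt (1 + (norm (g y))\<^sup>2) * \<psi> (S y)"
      using supp[of "S y"] by (cases "S y \<in> B") (auto simp: B_def)
  qed
  finally show ?thesis
    by (simp add: S_def)
qed

text \<open>The area element is bounded over a compact piece of a chart, and the parameters of that piece form a
  bounded subset of the hyperplane.\<close>

lemma emeasure_surface_chart_finite:
  fixes \<Omega> :: "'a::euclidean_space set"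
  assumes \<sigma>: "is_surface_measure \<Omega> \<sigma>" and chart: "graph_chart \<Omega> U \<nu> h g" and C: "cball p r \<subseteq> U"
  shows "emeasure \<sigma> (frontier \<Omega> \<inter> cball p r) < \<infinity>"
proof -
  note ch = graph_chartD[OF chart]
  define R where "R = norm p + r"
  let ?A = "frontier \<Omega> \<inter> cball p r"
  have "compact ((\<lambda>y. sqrt (1 + (norm (g y))\<^sup>2)) ` cball 0 R)"
    by (intro compact_continuous_image continuous_intros C1_with_grad_continuous[OF ch(3)]) auto
  then obtain c where c: "\<And>y. y \<in> cball 0 R \<Longrightarrow> sqrt (1 + (norm (g y))\<^sup>2) \<le> c"
    using compact_imp_bounded[of "(\<lambda>y. sqrt (1 + (norm (g y))\<^sup>2)) ` cball 0 R"]
    by (force simp: bounded_iff)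
  have "?A \<in> sets borel" "?A \<subseteq> frontier \<Omega> \<inter> U"
    using C by auto
  then have "emeasure \<sigma> ?A = (\<integral>\<^sup>+ y. ennreal (sqrt (1 + (norm (g y))\<^sup>2)) * indicator ?A (y + h y *\<^sub>R \<nu>)
        \<partial>hyperplane_lborel \<nu>)"
    using \<sigma> chart unfolding is_surface_measure_def by blast
  also have "\<dots> \<le> (\<integral>\<^sup>+ y. ennreal c * indicator (cball 0 R) y \<partial>hyperplane_lborel \<nu>)"
  proof (rule nn_integral_mono_AE)
    show "AE y in hyperplane_lborel \<nu>. ennreal (sqrt (1 + (norm (g y))\<^sup>2)) * indicator ?A (y + h y *\<^sub>R \<nu>)
        \<le> ennreal c * indicator (cball 0 R) y"
      using AE_hyperplane_lborel_orthogonal[OF ch(2)]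
    proof eventually_elim
      case (elim y)
      show ?case
      proof (cases "y + h y *\<^sub>R \<nu> \<in> ?A")
        case True
        then have "norm (y + h y *\<^sub>R \<nu>) \<le> R"
          using norm_triangle_ineq2[of "y + h y *\<^sub>R \<nu>" p] by (auto simp: R_def dist_norm norm_minus_commute)
        \<comment> \<open>The graph map moves \<open>y\<close> orthogonally to the hyperplane, hence does not decrease its norm.\<close>
        moreover have "(norm y)\<^sup>2 \<le> (norm (y + h y *\<^sub>R \<nu>))\<^sup>2"
          using elim signed_axis_norm[OF ch(2)]
          by (simp add: power2_norm_eq_inner inner_add_left inner_add_right inner_commute)
        then have "norm y \<le> norm (y + h y *\<^sub>R \<nu>)"
          by (rule power2_le_imp_le) simp
        ultimately have "y \<in> cball 0 R"
          by simp
        then show ?thesis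
          using c[of y] by (auto simp: indicator_def intro!: ennreal_leI)
      qed simp
    qed
  qed
  also have "\<dots> = ennreal c * emeasure (hyperplane_lborel \<nu>) (cball 0 R)"
    by (subst nn_integral_cmult_indicator) auto
  also have "\<dots> < \<infinity>"
    using emeasure_hyperplane_lborel_cball[OF ch(2), of R] by (simp add: ennreal_mult_less_top)
  finally show ?thesis .
qed

text \<open>The boundary is compact, so finitely many compact pieces of charts cover it.\<close>

lemma finite_surface_measure:
  fixes \<Omega> :: "'a::euclidean_space set"
  assumes dom: "bounded_smooth_domain \<Omega>" and \<sigma>: "is_surface_measure \<Omega> \<sigma>"
  shows "finite_measure \<sigma>"
proof
  have s[simp]: "sets \<sigma> = sets borel" "space \<sigma> = UNIV"
    using \<sigma> by (auto simp: is_surface_measure_def dest: sets_eq_imp_space_eq)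
  have "\<forall>p\<in>frontier \<Omega>. \<exists>r>0. emeasure \<sigma> (frontier \<Omega> \<inter> cball p r) < \<infinity>"
  proof
    fix p assume "p \<in> frontier \<Omega>"
    then obtain U \<nu> h g where U: "p \<in> U" and chart: "graph_chart \<Omega> U \<nu> h g"
      using dom unfolding bounded_smooth_domain_def by blast
    then obtain r where "r > 0" "cball p r \<subseteq> U"
      using graph_chartD(1)[OF chart] open_contains_cball by blast
    then show "\<exists>r>0. emeasure \<sigma> (frontier \<Omega> \<inter> cball p r) < \<infinity>"
      using emeasure_surface_chart_finite[OF \<sigma> chart] by blast
  qed
  then obtain r where r: "\<And>p. p \<in> frontier \<Omega> \<Longrightarrow> r p > 0"
    "\<And>p. p \<in> frontier \<Omega> \<Longrightarrow> emeasure \<sigma> (frontier \<Omega> \<inter> cball p (r p)) < \<infinity>"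
    by metis
  have "compact (frontier \<Omega>)"
    using dom by (auto simp: bounded_smooth_domain_def intro: compact_frontier_bounded)
  then obtain D where D: "D \<subseteq> frontier \<Omega>" "finite D" "frontier \<Omega> \<subseteq> (\<Union>p\<in>D. ball p (r p))"
    by (rule compactE_image[of _ "frontier \<Omega>" "\<lambda>p. ball p (r p)"]) (use r in auto)
  have "frontier \<Omega> = (\<Union>p\<in>D. frontier \<Omega> \<inter> cball p (r p))"
    using D(3) ball_subset_cball by blast
  then have "emeasure \<sigma> (frontier \<Omega>) \<le> (\<Sum>p\<in>D. emeasure \<sigma> (frontier \<Omega> \<inter> cball p (r p)))"
    using emeasure_subadditive_finite[OF D(2), of "\<lambda>p. frontier \<Omega> \<inter> cball p (r p)" \<sigma>]
    by (simp add: image_subset_iff)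
  also have "\<dots> < \<infinity>"
    using D(1,2) r(2) by (auto simp: less_top[symmetric])
  finally have fin: "emeasure \<sigma> (frontier \<Omega>) < \<infinity>" .
  have "emeasure \<sigma> (space \<sigma>) \<le> emeasure \<sigma> (frontier \<Omega>) + emeasure \<sigma> (- frontier \<Omega>)"
    using emeasure_subadditive[of "frontier \<Omega>" \<sigma> "- frontier \<Omega>"] by simp
  also have "emeasure \<sigma> (- frontier \<Omega>) = 0"
    using \<sigma> by (simp add: is_surface_measure_def)
  finally show "emeasure \<sigma> (space \<sigma>) \<noteq> \<infinity>"
    using fin by auto
qed

section \<open>The divergence theorem for smooth domains\<close>

text \<open>Within the support the domain is a subgraph. The area element cancels the normalisation of the outward
  normal.\<close>

lemma divergence_chart:
  fixes \<Omega> :: "'a::euclidean_space set"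
  assumes dom: "bounded_smooth_domain \<Omega>" and \<sigma>: "is_surface_measure \<Omega> \<sigma>"
    and chart: "graph_chart \<Omega> U \<nu> h g"
    and \<phi>: "C1_with_grad \<phi> G" and K: "compact K" "K \<subseteq> U" "\<And>x. x \<notin> K \<Longrightarrow> \<phi> x = 0"
    and e: "e \<in> Basis"
  shows "(\<integral>x. indicator \<Omega> x * (G x \<bullet> e) \<partial>lborel) = (\<integral>x. \<phi> x * (boundary_normal \<Omega> x \<bullet> e) \<partial>\<sigma>)"
proof -
  note ch = graph_chartD[OF chart]
  have op: "open \<Omega>"
    using dom by (simp add: bounded_smooth_domain_def)
  note [measurable] = C1_with_grad_measurable[OF \<phi>] C1_with_grad_measurable[OF ch(3)]
    boundary_normal_measurable[OF dom]
  have G0: "G x = 0" if "x \<notin> K" for x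
    using C1_with_grad_zero_outside[OF \<phi> K(1,3) that] .
  have "(\<integral>x. indicator \<Omega> x * (G x \<bullet> e) \<partial>lborel) =
      (\<integral>x. indicator {x. x \<bullet> \<nu> < h x} x * (G x \<bullet> e) \<partial>lborel)"
  proof (rule Bochner_Integration.integral_cong[OF refl])
    fix x show "indicator \<Omega> x * (G x \<bullet> e) = indicator {x. x \<bullet> \<nu> < h x} x * (G x \<bullet> e)"
      by (cases "x \<in> K") (use K(2) ch(5)[of x] in \<open>auto simp: indicator_def G0\<close>)
  qed
  also have "\<dots> = (\<integral>y. ((\<nu> - g y) \<bullet> e) * \<phi> (y + h y *\<^sub>R \<nu>) \<partial>hyperplane_lborel \<nu>)"
    by (rule divergence_subgraph[OF ch(2,3,4) \<phi> K(1,3) e])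
  also have "\<dots> = (\<integral>y. sqrt (1 + (norm (g y))\<^sup>2) *
       (\<phi> (y + h y *\<^sub>R \<nu>) * (boundary_normal \<Omega> (y + h y *\<^sub>R \<nu>) \<bullet> e)) \<partial>hyperplane_lborel \<nu>)"
  proof (rule integral_cong_AE)
    show "AE y in hyperplane_lborel \<nu>. ((\<nu> - g y) \<bullet> e) * \<phi> (y + h y *\<^sub>R \<nu>) = sqrt (1 + (norm (g y))\<^sup>2) *
       (\<phi> (y + h y *\<^sub>R \<nu>) * (boundary_normal \<Omega> (y + h y *\<^sub>R \<nu>) \<bullet> e))"
      using AE_hyperplane_lborel_orthogonal[OF ch(2)]
    proof eventually_elim
      case (elim y)
      let ?x = "y + h y *\<^sub>R \<nu>"
      show ?case
      proof (cases "?x \<in> K")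
        case True
        then have U: "?x \<in> U"
          using K(2) by auto
        have "?x \<bullet> \<nu> = h ?x"
          using elim signed_axis_norm[OF ch(2)] by (simp add: inner_add_left ch(4))
        then have fr: "?x \<in> frontier \<Omega>"
          using frontier_in_chart[OF chart op U] by simp
        then have "boundary_normal \<Omega> ?x = (\<nu> - g y) /\<^sub>R sqrt (1 + (norm (g y))\<^sup>2)"
          unfolding boundary_normal_def outward_unit_normal_chart[OF chart op U fr]
          by (simp add: graph_chart_orthogonal(2)[OF chart])
        then show ?thesis
          using sqrt_1_plus_sq_pos(1)[of "norm (g y)"] by simp
      qed (simp add: K(3))
    qed
  qed measurable
  also have "\<dots> = (\<integral>x. \<phi> x * (boundary_normal \<Omega> x \<bullet> e) \<partial>\<sigma>)"
    by (rule surface_integral_in_chart[OF \<sigma> chart, symmetric])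
       (use K(2,3) in \<open>measurable, auto simp: boundary_normal_def\<close>)
  finally show ?thesis .
qed

text \<open>For functions supported in a chart the theorem is \<open>divergence_chart\<close>, and for functions supported inside
  \<open>\<Omega>\<close> both sides vanish. Instead of a partition of unity, cutoff functions \<open>\<theta>\<close> are removed one at a time:
  \<open>\<phi> = \<phi> * \<theta> + (\<phi> - \<phi> * \<theta>)\<close>, where the first summand is local and the second vanishes where \<open>\<theta> = 1\<close>. After
  finitely many steps the rest vanishes in a neighbourhood of the closure of \<open>\<Omega>\<close>.\<close>

lemma divergence_theorem:
  fixes \<Omega> :: "'a::euclidean_space set"
  assumes dom: "bounded_smooth_domain \<Omega>" and \<sigma>: "is_surface_measure \<Omega> \<sigma>"
    and \<phi>: "C1_with_grad \<phi> G" and e: "e \<in> Basis"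
  shows "(\<integral>x. indicator \<Omega> x * (G x \<bullet> e) \<partial>lborel) = (\<integral>x. \<phi> x * (boundary_normal \<Omega> x \<bullet> e) \<partial>\<sigma>)"
proof -
  interpret \<sigma>: finite_measure \<sigma>
    by (rule finite_surface_measure[OF dom \<sigma>])
  have s[measurable_cong]: "sets \<sigma> = sets borel"
    using \<sigma> by (simp add: is_surface_measure_def)
  have op: "open \<Omega>" and bd: "bounded \<Omega>"
    using dom by (auto simp: bounded_smooth_domain_def)
  have cpt: "compact (closure \<Omega>)" "compact (frontier \<Omega>)"
    using bd by (auto simp: compact_closure compact_frontier_bounded)
  note [measurable] = boundary_normal_measurable[OF dom]
  define DIV where "DIV \<phi> G \<longleftrightarrow>
    (\<integral>x. indicator \<Omega> x * (G x \<bullet> e) \<partial>lborel) = (\<integral>x. \<phi> x * (boundary_normal \<Omega> x \<bullet> e) \<partial>\<sigma>)"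
    for \<phi> :: "'a \<Rightarrow> real" and G :: "'a \<Rightarrow> 'a"
  have int_vol: "integrable lborel (\<lambda>x. indicator \<Omega> x * (G x \<bullet> e))" if "C1_with_grad \<phi> G" for \<phi> G
  proof -
    have "integrable lborel (\<lambda>x. indicator (closure \<Omega>) x *\<^sub>R (G x \<bullet> e))"
      by (intro borel_integrable_compact[OF cpt(1)] continuous_intros C1_with_grad_continuous[OF that])
    from integrable_mult_indicator[OF _ this, of \<Omega>] op
    have "integrable lborel (\<lambda>x. indicator \<Omega> x *\<^sub>R indicator (closure \<Omega>) x *\<^sub>R (G x \<bullet> e))"
      by simp
    also have "(\<lambda>x. indicator \<Omega> x *\<^sub>R indicator (closure \<Omega>) x *\<^sub>R (G x \<bullet> e)) = (\<lambda>x. indicator \<Omega> x * (G x \<bullet> e))"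
      using closure_subset by (force simp: indicator_def)
    finally show ?thesis .
  qed
  have int_surf: "integrable \<sigma> (\<lambda>x. \<phi> x * (boundary_normal \<Omega> x \<bullet> e))" if "C1_with_grad \<phi> G" for \<phi> G
  proof -
    note [measurable] = C1_with_grad_measurable[OF that]
    have "compact (\<phi> ` frontier \<Omega>)"
      by (intro compact_continuous_image cpt C1_with_grad_continuous[OF that])
    then obtain c where c: "\<And>x. x \<in> frontier \<Omega> \<Longrightarrow> \<bar>\<phi> x\<bar> \<le> c"
      using compact_imp_bounded[of "\<phi> ` frontier \<Omega>"] by (force simp: bounded_iff)
    have "\<bar>\<phi> x * (boundary_normal \<Omega> x \<bullet> e)\<bar> \<le> \<bar>c\<bar>" for x
    proof (cases "x \<in> frontier \<Omega>")
      case True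
      have "\<bar>boundary_normal \<Omega> x \<bullet> e\<bar> \<le> 1"
        using Basis_le_norm[OF e] norm_boundary_normal_le[OF dom, of x] order_trans by blast
      then have "\<bar>\<phi> x\<bar> * \<bar>boundary_normal \<Omega> x \<bullet> e\<bar> \<le> \<bar>c\<bar> * 1"
        using c[OF True] by (intro mult_mono) auto
      then show ?thesis
        by (simp add: abs_mult)
    qed (simp add: boundary_normal_def)
    then show ?thesis
      by (intro \<sigma>.integrable_const_bound[where B = "\<bar>c\<bar>"]) auto
  qed
  have add: "DIV (\<lambda>x. \<phi> x + \<psi> x) (\<lambda>x. G x + H x)"
    if "C1_with_grad \<phi> G" "C1_with_grad \<psi> H" "DIV \<phi> G" "DIV \<psi> H" for \<phi> \<psi> G H
    using that unfolding DIV_def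
    by (simp add: inner_add_left distrib_left distrib_right int_vol int_surf)
  \<comment> \<open>One predicate for interior and for boundary points, so that a single finite subcover of the closure
    serves both.\<close>
  define cutoff where "cutoff p r \<theta> t \<longleftrightarrow> 0 < r \<and> C1_with_grad \<theta> t \<and> (\<forall>x\<in>ball p r. \<theta> x = 1) \<and>
      (\<forall>\<phi> G. C1_with_grad \<phi> G \<longrightarrow> DIV (\<lambda>x. \<phi> x * \<theta> x) (\<lambda>x. \<phi> x *\<^sub>R t x + \<theta> x *\<^sub>R G x))"
    for p :: 'a and r \<theta> t
  have "\<exists>r \<theta> t. cutoff p r \<theta> t"
    if p: "p \<in> closure \<Omega>" for p
  proof (cases "p \<in> \<Omega>")
    case True
    then obtain r where r: "r > 0" "cball p r \<subseteq> \<Omega>"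
      using op open_contains_cball by blast
    obtain \<theta> t where \<theta>: "C1_with_grad \<theta> t" "\<And>x. x \<notin> cball p r \<Longrightarrow> \<theta> x = 0"
      "\<And>x. x \<in> ball p (r / 2) \<Longrightarrow> \<theta> x = 1"
      by (rule exists_C1_bump[OF r(1)]) blast
    have "DIV (\<lambda>x. \<phi> x * \<theta> x) (\<lambda>x. \<phi> x *\<^sub>R t x + \<theta> x *\<^sub>R G x)" if \<phi>: "C1_with_grad \<phi> G" for \<phi> G
    proof -
      let ?H = "\<lambda>x. \<phi> x *\<^sub>R t x + \<theta> x *\<^sub>R G x"
      have C: "C1_with_grad (\<lambda>x. \<phi> x * \<theta> x) ?H"
        by (rule C1_with_grad_mult[OF \<phi> \<theta>(1)])
      have z: "\<phi> x * \<theta> x = 0" if "x \<notin> cball p r" for x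
        using \<theta>(2)[OF that] by simp
      have H0: "?H x = 0" if "x \<notin> cball p r" for x
        by (rule C1_with_grad_zero_outside[OF C compact_cball z that])
      have eq: "indicator \<Omega> x * (?H x \<bullet> e) = 1 * (?H x \<bullet> e)" for x
        by (cases "x \<in> cball p r") (use r(2) H0[of x] in \<open>auto simp: indicator_def\<close>)
      have "(\<integral>x. 1 * (?H x \<bullet> e) \<partial>lborel) = 0"
        by (rule integral_derivative_along_axis_eq_0[OF _ C compact_cball z])
           (use e int_vol[OF C] in \<open>auto simp: signed_axis_def eq\<close>)
      moreover have "\<phi> x * \<theta> x * (boundary_normal \<Omega> x \<bullet> e) = 0" for x
      proof (cases "x \<in> frontier \<Omega>")
        case True
        then have "x \<notin> cball p r"
          using r(2) op by (auto simp: frontier_def interior_open)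
        then show ?thesis
          using z by simp
      qed (simp add: boundary_normal_def)
      ultimately show ?thesis
        unfolding DIV_def eq by (simp only: mult_1_left Bochner_Integration.integral_zero)
    qed
    then have "cutoff p (r / 2) \<theta> t"
      using r(1) \<theta>(1,3) unfolding cutoff_def by (simp del: mem_ball)
    then show ?thesis
      by blast
  next
    case False
    then have "p \<in> frontier \<Omega>"
      using p op by (simp add: frontier_def interior_open)
    then obtain U \<nu> h g where U: "p \<in> U" and chart: "graph_chart \<Omega> U \<nu> h g"
      using dom unfolding bounded_smooth_domain_def by blast
    then obtain r where r: "r > 0" "cball p r \<subseteq> U"
      using graph_chartD(1)[OF chart] open_contains_cball by blast
    obtain \<theta> t where \<theta>: "C1_with_grad \<theta> t" "\<And>x. x \<notin> cball p r \<Longrightarrow> \<theta> x = 0"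
      "\<And>x. x \<in> ball p (r / 2) \<Longrightarrow> \<theta> x = 1"
      by (rule exists_C1_bump[OF r(1)]) blast
    have "DIV (\<lambda>x. \<phi> x * \<theta> x) (\<lambda>x. \<phi> x *\<^sub>R t x + \<theta> x *\<^sub>R G x)" if "C1_with_grad \<phi> G" for \<phi> G
      unfolding DIV_def
      by (rule divergence_chart[OF dom \<sigma> chart C1_with_grad_mult[OF that \<theta>(1)] compact_cball r(2) _ e])
         (simp add: \<theta>(2) del: mem_cball)
    then have "cutoff p (r / 2) \<theta> t"
      using r(1) \<theta>(1,3) unfolding cutoff_def by (simp del: mem_ball)
    then show ?thesis
      by blast
  qed
  then obtain r \<theta> t where "\<And>p. p \<in> closure \<Omega> \<Longrightarrow> cutoff p (r p) (\<theta> p) (t p)"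
    by metis
  then have b: "\<And>p. p \<in> closure \<Omega> \<Longrightarrow> 0 < r p"
    "\<And>p. p \<in> closure \<Omega> \<Longrightarrow> C1_with_grad (\<theta> p) (t p)"
    "\<And>p x. p \<in> closure \<Omega> \<Longrightarrow> x \<in> ball p (r p) \<Longrightarrow> \<theta> p x = 1"
    "\<And>p \<phi> G. p \<in> closure \<Omega> \<Longrightarrow> C1_with_grad \<phi> G \<Longrightarrow>
       DIV (\<lambda>x. \<phi> x * \<theta> p x) (\<lambda>x. \<phi> x *\<^sub>R t p x + \<theta> p x *\<^sub>R G x)"
    unfolding cutoff_def by blast+
  \<comment> \<open>\<open>W\<close> collects the balls on which the function has already been cut down to \<open>0\<close>.\<close>
  have main: "DIV \<phi> G"
    if "finite D" "D \<subseteq> closure \<Omega>" "C1_with_grad \<phi> G" "open W" "\<And>x. x \<in> W \<Longrightarrow> \<phi> x = 0"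
      "closure \<Omega> \<subseteq> W \<union> (\<Union>p\<in>D. ball p (r p))" for D \<phi> G W
    using that
  proof (induction D arbitrary: \<phi> G W rule: finite_induct)
    case empty
    have G0: "G x = 0" if "x \<in> closure \<Omega>" for x
      using C1_with_grad_eq_0[OF empty(2-4)] empty(5) that by auto
    have "indicator \<Omega> x * (G x \<bullet> e) = 0" for x
      using G0[of x] closure_subset[of \<Omega>] by (auto simp: indicator_def)
    moreover have "\<phi> x * (boundary_normal \<Omega> x \<bullet> e) = 0" for x
      using empty(4)[of x] empty(5) by (auto simp: boundary_normal_def indicator_def frontier_def)
    ultimately show ?case
      unfolding DIV_def by (simp only: Bochner_Integration.integral_zero)
  next
    case (insert p D)
    have p: "p \<in> closure \<Omega>"
      using insert.prems by auto
    note C = insert.prems(2)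
    have C1: "C1_with_grad (\<lambda>x. \<phi> x * \<theta> p x) (\<lambda>x. \<phi> x *\<^sub>R t p x + \<theta> p x *\<^sub>R G x)"
      by (rule C1_with_grad_mult[OF C b(2)[OF p]])
    let ?\<psi> = "\<lambda>x. \<phi> x - \<phi> x * \<theta> p x" and ?H = "\<lambda>x. G x - (\<phi> x *\<^sub>R t p x + \<theta> p x *\<^sub>R G x)"
    have C2: "C1_with_grad ?\<psi> ?H"
      by (rule C1_with_grad_diff[OF C C1])
    have "DIV ?\<psi> ?H"
    proof (rule insert.IH[OF _ C2])
      show "open (W \<union> ball p (r p))"
        using insert.prems by auto
      show "?\<psi> x = 0" if "x \<in> W \<union> ball p (r p)" for x
        using that insert.prems(4) b(3)[OF p, of x] by (auto simp del: mem_ball)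
    qed (use insert.prems in auto)
    from add[OF C2 C1 this b(4)[OF p C]] show ?case
      by simp
  qed
  obtain D where "D \<subseteq> closure \<Omega>" "finite D" "closure \<Omega> \<subseteq> (\<Union>p\<in>D. ball p (r p))"
    by (rule compactE_image[OF cpt(1), of "closure \<Omega>" "\<lambda>p. ball p (r p)"]) (use b(1) in auto)
  then have "DIV \<phi> G"
    by (intro main[of D \<phi> G "{}"] \<phi>) auto
  then show ?thesis
    by (simp add: DIV_def)
qed

section \<open>Square-integrable functions\<close>

lemma L2_norm_nonneg [simp]: "L2_norm M v \<ge> 0"
  by (simp add: L2_norm_def)

lemma L2_fun_measurable [measurable_dest]: "L2_fun M v \<Longrightarrow> v \<in> borel_measurable M"
  by (simp add: L2_fun_def)

lemma L2_fun_bound: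
  assumes "L2_fun M w" "v \<in> borel_measurable M" "AE x in M. norm (v x) \<le> norm (w x)"
  shows "L2_fun M v" "L2_norm M v \<le> L2_norm M w"
proof -
  note [measurable] = assms(2) L2_fun_measurable[OF assms(1)]
  have sq: "AE x in M. (norm (v x))\<^sup>2 \<le> (norm (w x))\<^sup>2"
    using assms(3) by eventually_elim (simp add: power_mono)
  have int: "integrable M (\<lambda>x. (norm (w x))\<^sup>2)"
    using assms(1) by (simp add: L2_fun_def)
  have int': "integrable M (\<lambda>x. (norm (v x))\<^sup>2)"
    by (rule Bochner_Integration.integrable_bound[OF int]) (use sq in auto)
  then show "L2_fun M v"
    using assms(2) by (simp add: L2_fun_def)
  show "L2_norm M v \<le> L2_norm M w"
    unfolding L2_norm_def by (intro real_sqrt_le_mono integral_mono_AE int int' sq)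
qed

lemma integrable_L2_inner:
  assumes "L2_fun M v" "L2_fun M w"
  shows "integrable M (\<lambda>x. v x \<bullet> w x)"
proof -
  note [measurable] = assms[THEN L2_fun_measurable]
  have "\<bar>a \<bullet> b\<bar> \<le> (norm a)\<^sup>2 + (norm b)\<^sup>2" for a b :: 'b
  proof -
    have "\<bar>a \<bullet> b\<bar> \<le> norm a * norm b"
      by (rule Cauchy_Schwarz_ineq2)
    moreover have "0 \<le> (norm a - norm b)\<^sup>2" "0 \<le> norm a * norm b"
      by auto
    ultimately show ?thesis
      by (simp add: power2_diff)
  qed
  then have "AE x in M. norm (v x \<bullet> w x) \<le> norm ((norm (v x))\<^sup>2 + (norm (w x))\<^sup>2)"
    by (intro always_eventually allI) simp
  moreover have "integrable M (\<lambda>x. (norm (v x))\<^sup>2 + (norm (w x))\<^sup>2)"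
    using assms by (intro Bochner_Integration.integrable_add) (simp_all add: L2_fun_def)
  moreover have "(\<lambda>x. v x \<bullet> w x) \<in> borel_measurable M"
    by measurable
  ultimately show ?thesis
    by (blast intro: Bochner_Integration.integrable_bound)
qed

lemma L2_fun_scaleR:
  assumes "L2_fun M v" shows "L2_fun M (\<lambda>x. c *\<^sub>R v x)"
  unfolding L2_fun_def
proof
  show "(\<lambda>x. c *\<^sub>R v x) \<in> borel_measurable M"
    using L2_fun_measurable[OF assms] by (rule borel_measurable_const_scaleR)
  have "integrable M (\<lambda>x. c\<^sup>2 * (norm (v x))\<^sup>2)"
    using assms by (intro integrable_mult_right) (simp add: L2_fun_def)
  then show "integrable M (\<lambda>x. (norm (c *\<^sub>R v x))\<^sup>2)"
    by (simp only: norm_scaleR power_mult_distrib power2_abs)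
qed

lemma L2_fun_add:
  assumes "L2_fun M v" "L2_fun M w" shows "L2_fun M (\<lambda>x. v x + w x)"
proof -
  have "integrable M (\<lambda>x. v x \<bullet> v x + 2 * (v x \<bullet> w x) + w x \<bullet> w x)"
    by (intro Bochner_Integration.integrable_add integrable_mult_right integrable_L2_inner assms)
  also have "(\<lambda>x. v x \<bullet> v x + 2 * (v x \<bullet> w x) + w x \<bullet> w x) = (\<lambda>x. (norm (v x + w x))\<^sup>2)"
    by (simp add: fun_eq_iff power2_norm_eq_inner inner_add_left inner_add_right inner_commute)
  finally show ?thesis
    unfolding L2_fun_def using borel_measurable_add[OF assms[THEN L2_fun_measurable]] by blast
qed

lemma L2_fun_diff:
  assumes "L2_fun M v" "L2_fun M w" shows "L2_fun M (\<lambda>x. v x - w x)"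
  using L2_fun_add[OF assms(1) L2_fun_scaleR[OF assms(2), of "-1"]]
  by (simp only: scaleR_minus1_left add_uminus_conv_diff)

lemma L2_fun_component:
  assumes "L2_fun M v" "norm e \<le> 1"
  shows "L2_fun M (\<lambda>x. v x \<bullet> e)" "L2_norm M (\<lambda>x. v x \<bullet> e) \<le> L2_norm M v"
proof -
  note [measurable] = L2_fun_measurable[OF assms(1)]
  have *: "norm (v x \<bullet> e) \<le> norm (v x)" for x
    using Cauchy_Schwarz_ineq2[of "v x" e] mult_left_mono[OF assms(2), of "norm (v x)"] by simp
  show "L2_fun M (\<lambda>x. v x \<bullet> e)" "L2_norm M (\<lambda>x. v x \<bullet> e) \<le> L2_norm M v"
    using * by (auto intro!: L2_fun_bound[OF assms(1)])
qed

lemma tendsto_L2_norm_component: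
  assumes e: "norm e \<le> 1" and L2: "\<And>k. L2_fun M (vk k)" "L2_fun M v"
    and lim: "(\<lambda>k. L2_norm M (\<lambda>x. vk k x - v x)) \<longlonglongrightarrow> 0"
  shows "(\<lambda>k. L2_norm M (\<lambda>x. vk k x \<bullet> e - v x \<bullet> e)) \<longlonglongrightarrow> 0"
proof (rule Lim_null_comparison[OF _ lim], rule always_eventually, rule allI)
  fix k
  show "norm (L2_norm M (\<lambda>x. vk k x \<bullet> e - v x \<bullet> e)) \<le> L2_norm M (\<lambda>x. vk k x - v x)"
    using L2_fun_component(2)[OF L2_fun_diff[OF L2(1)[of k] L2(2)] e] by (simp add: inner_diff_left)
qed

lemma L2_inner_commute: "L2_inner M v w = L2_inner M w v"
  by (simp add: L2_inner_def inner_commute)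

lemma L2_inner_add_left:
  assumes "L2_fun M v" "L2_fun M v'" "L2_fun M w"
  shows "L2_inner M (\<lambda>x. v x + v' x) w = L2_inner M v w + L2_inner M v' w"
  unfolding L2_inner_def inner_add_left
  by (intro Bochner_Integration.integral_add integrable_L2_inner assms)

lemma L2_inner_diff_left:
  assumes "L2_fun M v" "L2_fun M v'" "L2_fun M w"
  shows "L2_inner M (\<lambda>x. v x - v' x) w = L2_inner M v w - L2_inner M v' w"
  unfolding L2_inner_def inner_diff_left
  by (intro Bochner_Integration.integral_diff integrable_L2_inner assms)

lemma L2_inner_diff_right:
  assumes "L2_fun M v" "L2_fun M v'" "L2_fun M w"
  shows "L2_inner M w (\<lambda>x. v x - v' x) = L2_inner M w v - L2_inner M w v'"
  unfolding L2_inner_def inner_diff_right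
  by (intro Bochner_Integration.integral_diff integrable_L2_inner assms)

lemma L2_inner_scaleR_left: "L2_inner M (\<lambda>x. c *\<^sub>R v x) w = c * L2_inner M v w"
  by (simp add: L2_inner_def)

lemma L2_inner_scaleR_right: "L2_inner M w (\<lambda>x. c *\<^sub>R v x) = c * L2_inner M w v"
  by (simp add: L2_inner_def)

text \<open>Lebesgue measure is complete, so the modified functions are again measurable.\<close>

lemma L2_inner_cong_AE_lebesgue_on:
  fixes v v' w w' :: "'a::euclidean_space \<Rightarrow> real"
  assumes \<Omega>: "\<Omega> \<in> sets lebesgue"
    and v: "AE x in lebesgue_on \<Omega>. v x = v' x" "v \<in> borel_measurable (lebesgue_on \<Omega>)"
    and w: "AE x in lebesgue_on \<Omega>. w x = w' x" "w \<in> borel_measurable (lebesgue_on \<Omega>)"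
  shows "L2_inner (lebesgue_on \<Omega>) v w = L2_inner (lebesgue_on \<Omega>) v' w'"
proof -
  have meas: "g \<in> borel_measurable (lebesgue_on \<Omega>)"
    if f: "f \<in> borel_measurable (lebesgue_on \<Omega>)" and eq: "AE x in lebesgue_on \<Omega>. f x = g x"
    for f g :: "'a \<Rightarrow> real"
  proof -
    have "AE x in lebesgue. f x * indicator \<Omega> x = g x * indicator \<Omega> x"
      using eq \<Omega> by (subst (asm) AE_restrict_space_iff) (auto simp: indicator_def elim: eventually_mono)
    from borel_measurable_AE[OF _ this] f \<Omega>
    have "(\<lambda>x. g x * indicator \<Omega> x) \<in> borel_measurable lebesgue"
      by (simp add: borel_measurable_restrict_space_iff mult.commute)
    then show ?thesis
      using \<Omega> by (simp add: borel_measurable_restrict_space_iff mult.commute)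
  qed
  have "v' \<in> borel_measurable (lebesgue_on \<Omega>)" "w' \<in> borel_measurable (lebesgue_on \<Omega>)"
    using meas v w by blast+
  moreover have "AE x in lebesgue_on \<Omega>. v x \<bullet> w x = v' x \<bullet> w' x"
    using v(1) w(1) by eventually_elim simp
  ultimately show ?thesis
    unfolding L2_inner_def using v(2) w(2) by (intro integral_cong_AE) auto
qed

lemma L2_norm_square: "(L2_norm M v)\<^sup>2 = L2_inner M v v"
  by (simp add: L2_norm_def L2_inner_def power2_norm_eq_inner)

lemma nonneg_quadratic_discriminant:
  fixes a b c :: real
  assumes "\<And>t. 0 \<le> a + 2 * t * c + t\<^sup>2 * b" and b: "b \<ge> 0"
  shows "c\<^sup>2 \<le> a * b"
proof (cases "b = 0")
  case True
  have "c = 0"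
  proof (rule ccontr)
    assume "c \<noteq> 0"
    then show False
      using assms(1)[of "- (a + 1) / (2 * c)"] True by (simp add: field_simps)
  qed
  then show ?thesis
    by (simp add: True)
next
  case False
  then have "b > 0"
    using b by simp
  then show ?thesis
    using assms(1)[of "- c / b"] by (simp add: power2_eq_square field_simps)
qed

lemma L2_Cauchy_Schwarz_square:
  assumes "L2_fun M v" "L2_fun M w"
  shows "(L2_inner M v w)\<^sup>2 \<le> (L2_norm M v)\<^sup>2 * (L2_norm M w)\<^sup>2"
proof -
  let ?a = "(L2_norm M v)\<^sup>2" and ?b = "(L2_norm M w)\<^sup>2" and ?c = "L2_inner M v w"
  \<comment> \<open>The quadratic is \<open>\<parallel>v + t w\<parallel>\<^sup>2\<close>.\<close>
  have pos: "0 \<le> ?a + 2 * t * ?c + t\<^sup>2 * ?b" for t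
  proof -
    let ?z = "\<lambda>x. v x + t *\<^sub>R w x"
    have tw: "L2_fun M (\<lambda>x. t *\<^sub>R w x)"
      by (rule L2_fun_scaleR[OF assms(2)])
    have z: "L2_fun M ?z"
      by (intro L2_fun_add assms tw)
    have "0 \<le> L2_inner M ?z ?z"
      unfolding L2_norm_square[symmetric] by simp
    also have "\<dots> = L2_inner M v ?z + t * L2_inner M w ?z"
      by (simp only: L2_inner_add_left[OF assms(1) tw z] L2_inner_scaleR_left)
    also have "\<dots> = L2_inner M ?z v + t * L2_inner M ?z w"
      by (simp only: L2_inner_commute[of M v ?z] L2_inner_commute[of M w ?z])
    also have "\<dots> = (?a + t * ?c) + t * (?c + t * ?b)"
      by (simp only: L2_inner_add_left[OF assms(1) tw assms(1)] L2_inner_add_left[OF assms(1) tw assms(2)]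
        L2_inner_scaleR_left L2_norm_square L2_inner_commute[of M w v])
    also have "\<dots> = ?a + 2 * t * ?c + t\<^sup>2 * ?b"
      by (simp add: power2_eq_square[of t] algebra_simps)
    finally show "0 \<le> ?a + 2 * t * ?c + t\<^sup>2 * ?b" .
  qed
  show ?thesis
    by (rule nonneg_quadratic_discriminant[OF pos]) simp
qed

lemma L2_Cauchy_Schwarz:
  assumes "L2_fun M v" "L2_fun M w"
  shows "\<bar>L2_inner M v w\<bar> \<le> L2_norm M v * L2_norm M w"
proof (rule power2_le_imp_le)
  show "\<bar>L2_inner M v w\<bar>\<^sup>2 \<le> (L2_norm M v * L2_norm M w)\<^sup>2"
    using L2_Cauchy_Schwarz_square[OF assms] by (simp add: power_mult_distrib)
qed simp

text \<open>By bilinearity and the Cauchy-Schwarz inequality applied to the differences.\<close>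

lemma tendsto_L2_inner:
  assumes v: "\<forall>\<^sub>F k in F. L2_fun M (vk k)" "L2_fun M v" "((\<lambda>k. L2_norm M (\<lambda>x. vk k x - v x)) \<longlongrightarrow> 0) F"
    and w: "\<forall>\<^sub>F k in F. L2_fun M (wk k)" "L2_fun M w" "((\<lambda>k. L2_norm M (\<lambda>x. wk k x - w x)) \<longlongrightarrow> 0) F"
  shows "((\<lambda>k. L2_inner M (vk k) (wk k)) \<longlongrightarrow> L2_inner M v w) F"
proof (rule LIM_zero_cancel, rule Lim_null_comparison)
  let ?a = "\<lambda>k. L2_norm M (\<lambda>x. vk k x - v x)" and ?b = "\<lambda>k. L2_norm M (\<lambda>x. wk k x - w x)"
  show "((\<lambda>k. ?a k * ?b k + ?a k * L2_norm M w + L2_norm M v * ?b k) \<longlongrightarrow> 0) F"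
    using tendsto_add[OF tendsto_add[OF tendsto_mult[OF v(3) w(3)]
        tendsto_mult_left_zero[OF v(3), of "L2_norm M w"]] tendsto_mult_right_zero[OF w(3), of "L2_norm M v"]]
    by simp
  show "\<forall>\<^sub>F k in F. norm (L2_inner M (vk k) (wk k) - L2_inner M v w)
      \<le> ?a k * ?b k + ?a k * L2_norm M w + L2_norm M v * ?b k"
    using v(1) w(1)
  proof eventually_elim
    case (elim k)
    let ?dv = "\<lambda>x. vk k x - v x" and ?dw = "\<lambda>x. wk k x - w x"
    have dv: "L2_fun M ?dv" and dw: "L2_fun M ?dw"
      by (intro L2_fun_diff elim v w)+
    have split: "L2_inner M (vk k) (wk k) - L2_inner M v w =
        L2_inner M ?dv ?dw + L2_inner M ?dv w + L2_inner M v ?dw"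
      by (simp only: L2_inner_diff_left[OF elim(1) v(2) dw] L2_inner_diff_left[OF elim(1) v(2) w(2)]
        L2_inner_diff_right[OF elim(2) w(2) v(2)] L2_inner_diff_right[OF elim(2) w(2) elim(1)])
    show ?case
      using L2_Cauchy_Schwarz[OF dv dw] L2_Cauchy_Schwarz[OF dv w(2)] L2_Cauchy_Schwarz[OF v(2) dw]
      unfolding split real_norm_def by linarith
  qed
qed

text \<open>In the product rule the factor \<open>w\<close> is evaluated at the moving time; this is where its continuity enters.\<close>

lemma has_derivative_L2_inner:
  assumes v: "L2_has_derivative I M v v'" and w: "L2_has_derivative I M w w'" "L2_continuous I M w"
    and t: "t \<in> I"
  shows "((\<lambda>t. L2_inner M (v t) (w t)) has_real_derivative
      L2_inner M (v' t) (w t) + L2_inner M (v t) (w' t)) (at t within I)"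
  unfolding has_field_derivative_iff
proof (rule Lim_transform_eventually)
  \<comment> \<open>Product rule: the difference quotient of the inner product is \<open>\<langle>?qv s, w s\<rangle> + \<langle>v t, ?qw s\<rangle>\<close>.\<close>
  let ?qv = "\<lambda>s x. (v s x - v t x) /\<^sub>R (s - t)" and ?qw = "\<lambda>s x. (w s x - w t x) /\<^sub>R (s - t)"
  have L2: "L2_fun M (v s)" "L2_fun M (v' s)" "L2_fun M (w s)" "L2_fun M (w' s)" if "s \<in> I" for s
    using v w that by (auto simp: L2_has_derivative_def)
  have q: "L2_fun M (?qv s)" "L2_fun M (?qw s)" if "s \<in> I" for s
    by (intro L2_fun_scaleR L2_fun_diff L2 that t)+
  have ev: "\<forall>\<^sub>F s in at t within I. s \<in> I \<and> s \<noteq> t"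
    by (auto simp: eventually_at_filter)
  show "((\<lambda>s. L2_inner M (?qv s) (w s) + L2_inner M (v t) (?qw s)) \<longlongrightarrow>
      L2_inner M (v' t) (w t) + L2_inner M (v t) (w' t)) (at t within I)"
  proof (intro tendsto_add tendsto_L2_inner)
    show "\<forall>\<^sub>F s in at t within I. L2_fun M (?qv s)" "\<forall>\<^sub>F s in at t within I. L2_fun M (?qw s)"
      "\<forall>\<^sub>F s in at t within I. L2_fun M (w s)" "\<forall>\<^sub>F s in at t within I. L2_fun M (v t)"
      using ev by (eventually_elim, use q L2 t in blast)+
    show "((\<lambda>s. L2_norm M (\<lambda>x. v t x - v t x)) \<longlongrightarrow> 0) (at t within I)"
      by (simp add: L2_norm_def)
  qed (use v w t L2 in \<open>auto simp: L2_has_derivative_def L2_continuous_def\<close>)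
  show "\<forall>\<^sub>F s in at t within I. L2_inner M (?qv s) (w s) + L2_inner M (v t) (?qw s) =
      (L2_inner M (v s) (w s) - L2_inner M (v t) (w t)) / (s - t)"
    using ev
  proof eventually_elim
    case (elim s)
    then have s: "s \<in> I" "s - t \<noteq> 0"
      by auto
    have 1: "L2_inner M (?qv s) (w s) = (L2_inner M (v s) (w s) - L2_inner M (v t) (w s)) / (s - t)"
      by (simp only: L2_inner_scaleR_left L2_inner_diff_left[OF L2(1)[OF s(1)] L2(1)[OF t] L2(3)[OF s(1)]])
         (simp add: divide_inverse mult.commute)
    have 2: "L2_inner M (v t) (?qw s) = (L2_inner M (v t) (w s) - L2_inner M (v t) (w t)) / (s - t)"
      by (simp only: L2_inner_scaleR_right L2_inner_diff_right[OF L2(3)[OF s(1)] L2(3)[OF t] L2(1)[OF t]])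
         (simp add: divide_inverse mult.commute)
    show ?case
      unfolding 1 2 by (simp add: diff_divide_distrib)
  qed
qed

section \<open>Green's identity for weak derivatives and traces\<close>

lemma weak_grad_has_weak_grad:
  "v \<in> H1 \<Omega> \<Longrightarrow> has_weak_grad \<Omega> v (weak_grad \<Omega> v)"
  unfolding H1_def weak_grad_def by (simp add: someI_ex[where P = "has_weak_grad \<Omega> v"])

lemma H1_L2_fun:
  assumes "v \<in> H1 \<Omega>"
  shows "L2_fun (lebesgue_on \<Omega>) v" "L2_fun (lebesgue_on \<Omega>) (weak_grad \<Omega> v)"
  using weak_grad_has_weak_grad[OF assms] by (auto simp: has_weak_grad_def)

lemma boundary_trace_has_trace:
  "has_trace \<Omega> \<sigma> v \<gamma> \<Longrightarrow> has_trace \<Omega> \<sigma> v (boundary_trace \<Omega> \<sigma> v)"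
  unfolding boundary_trace_def by (rule someI[where P = "has_trace \<Omega> \<sigma> v"])

text \<open>Continuous functions are bounded on the compact closure, and a bounded set has finite measure.\<close>

lemma L2_fun_continuous_domain:
  fixes v :: "'a::euclidean_space \<Rightarrow> 'b::euclidean_space"
  assumes v: "continuous_on UNIV v" and \<Omega>: "open \<Omega>" "bounded \<Omega>"
  shows "L2_fun (lebesgue_on \<Omega>) v"
proof -
  have "compact (v ` closure \<Omega>)"
    using \<Omega> by (intro compact_continuous_image continuous_on_subset[OF v]) (auto simp: compact_closure)
  then obtain c where c: "\<And>x. x \<in> closure \<Omega> \<Longrightarrow> norm (v x) \<le> c"
    using compact_imp_bounded[of "v ` closure \<Omega>"] by (force simp: bounded_iff)
  have m: "v \<in> borel_measurable (lebesgue_on \<Omega>)"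
    using \<Omega> by (intro continuous_imp_measurable_on_sets_lebesgue continuous_on_subset[OF v])
                (auto intro: borel_open)
  interpret finite_measure "lebesgue_on \<Omega>"
  proof
    show "emeasure (lebesgue_on \<Omega>) (space (lebesgue_on \<Omega>)) \<noteq> \<infinity>"
      using emeasure_bounded_finite[OF \<Omega>(2)] \<Omega>(1)
      by (subst emeasure_restrict_space) (auto simp: borel_open emeasure_completion)
  qed
  have "integrable (lebesgue_on \<Omega>) (\<lambda>x. (norm (v x))\<^sup>2)"
    using m c closure_subset[of \<Omega>]
    by (intro integrable_const_bound[where B = "c\<^sup>2"]) (auto simp: space_restrict_space intro!: power_mono AE_I2)
  with m show ?thesis
    by (simp add: L2_fun_def)
qed

lemma L2_fun_continuous_boundary:
  fixes v :: "'a::euclidean_space \<Rightarrow> 'b::euclidean_space"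
  assumes v: "continuous_on UNIV v" and dom: "bounded_smooth_domain \<Omega>"
    and \<sigma>: "is_surface_measure \<Omega> \<sigma>"
  shows "L2_fun \<sigma> v"
proof -
  interpret finite_measure \<sigma>
    by (rule finite_surface_measure[OF dom \<sigma>])
  have "compact (v ` frontier \<Omega>)"
    using dom by (intro compact_continuous_image continuous_on_subset[OF v])
      (auto simp: bounded_smooth_domain_def compact_frontier_bounded)
  then obtain c where c: "\<And>x. x \<in> frontier \<Omega> \<Longrightarrow> norm (v x) \<le> c"
    using compact_imp_bounded[of "v ` frontier \<Omega>"] by (force simp: bounded_iff)
  have s: "sets \<sigma> = sets borel"
    using \<sigma> by (simp add: is_surface_measure_def)
  have m: "v \<in> borel_measurable \<sigma>"
    using borel_measurable_continuous_onI[OF v] measurable_cong_sets[OF s refl] by blast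
  have "AE x in \<sigma>. norm ((norm (v x))\<^sup>2) \<le> c\<^sup>2"
    using AE_frontier[OF \<sigma>] by eventually_elim (auto intro!: power_mono c)
  then have "integrable \<sigma> (\<lambda>x. (norm (v x))\<^sup>2)"
    using m by (intro integrable_const_bound[where B = "c\<^sup>2"]) auto
  with m show ?thesis
    by (simp add: L2_fun_def)
qed

lemma integral_lebesgue_on_eq_lborel:
  fixes F :: "'a::euclidean_space \<Rightarrow> real"
  assumes [measurable]: "F \<in> borel_measurable borel" "\<Omega> \<in> sets borel"
  shows "(\<integral>x. F x \<partial>lebesgue_on \<Omega>) = (\<integral>x. indicator \<Omega> x * F x \<partial>lborel)"
proof -
  have "(\<integral>x. F x \<partial>lebesgue_on \<Omega>) = (\<integral>x. indicator \<Omega> x *\<^sub>R F x \<partial>lebesgue)"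
    by (rule integral_restrict_space) auto
  also have "\<dots> = (\<integral>x. indicator \<Omega> x *\<^sub>R F x \<partial>lborel)"
    by (rule integral_completion) auto
  finally show ?thesis
    by simp
qed

text \<open>For continuously differentiable functions this is the divergence theorem applied to a product. The
  definition of the trace provides approximations that converge at once in \<open>H\<^sup>1(\<Omega>)\<close> and on the boundary,
  so every term passes to the limit.\<close>

lemma integration_by_parts_traces:
  fixes \<Omega> :: "'a::euclidean_space set"
  assumes dom: "bounded_smooth_domain \<Omega>" and \<sigma>: "is_surface_measure \<Omega> \<sigma>"
    and v: "has_trace \<Omega> \<sigma> v \<gamma>" and w: "has_trace \<Omega> \<sigma> w \<delta>" and e: "e \<in> Basis"
  shows "L2_inner (lebesgue_on \<Omega>) v (\<lambda>x. weak_grad \<Omega> w x \<bullet> e) +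
      L2_inner (lebesgue_on \<Omega>) w (\<lambda>x. weak_grad \<Omega> v x \<bullet> e) =
    L2_inner \<sigma> \<gamma> (\<lambda>x. \<delta> x * (boundary_normal \<Omega> x \<bullet> e))"
proof -
  let ?M = "lebesgue_on \<Omega>"
  have \<Omega>: "open \<Omega>" "bounded \<Omega>"
    using dom by (auto simp: bounded_smooth_domain_def)
  have s[measurable_cong]: "sets \<sigma> = sets borel"
    using \<sigma> by (simp add: is_surface_measure_def)
  note [measurable] = boundary_normal_measurable[OF dom] borel_open[OF \<Omega>(1)]
  obtain \<phi> g where \<phi>: "\<And>k::nat. C1_with_grad (\<phi> k) (g k)"
    and \<phi>_lim: "(\<lambda>k. L2_norm ?M (\<lambda>x. \<phi> k x - v x)) \<longlonglongrightarrow> 0"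
      "(\<lambda>k. L2_norm ?M (\<lambda>x. g k x - weak_grad \<Omega> v x)) \<longlonglongrightarrow> 0"
      "(\<lambda>k. L2_norm \<sigma> (\<lambda>x. \<phi> k x - \<gamma> x)) \<longlonglongrightarrow> 0"
    and v': "v \<in> H1 \<Omega>" "L2_fun \<sigma> \<gamma>"
    using v unfolding has_trace_def by blast
  obtain \<psi> h where \<psi>: "\<And>k::nat. C1_with_grad (\<psi> k) (h k)"
    and \<psi>_lim: "(\<lambda>k. L2_norm ?M (\<lambda>x. \<psi> k x - w x)) \<longlonglongrightarrow> 0"
      "(\<lambda>k. L2_norm ?M (\<lambda>x. h k x - weak_grad \<Omega> w x)) \<longlonglongrightarrow> 0"
      "(\<lambda>k. L2_norm \<sigma> (\<lambda>x. \<psi> k x - \<delta> x)) \<longlonglongrightarrow> 0"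
    and w': "w \<in> H1 \<Omega>" "L2_fun \<sigma> \<delta>"
    using w unfolding has_trace_def by blast
  note [measurable] = \<phi>[THEN C1_with_grad_measurable(1)] \<phi>[THEN C1_with_grad_measurable(2)]
    \<psi>[THEN C1_with_grad_measurable(1)] \<psi>[THEN C1_with_grad_measurable(2)]
    v'(2)[THEN L2_fun_measurable] w'(2)[THEN L2_fun_measurable]
  have e1: "norm e \<le> 1"
    using e by simp
  have L2M: "L2_fun ?M (\<phi> k)" "L2_fun ?M (g k)" "L2_fun ?M (\<psi> k)" "L2_fun ?M (h k)" for k
    by (intro L2_fun_continuous_domain[OF _ \<Omega>] C1_with_grad_continuous[OF \<phi>] C1_with_grad_continuous[OF \<psi>])+
  have L2\<sigma>: "L2_fun \<sigma> (\<phi> k)" "L2_fun \<sigma> (\<psi> k)" for k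
    by (intro L2_fun_continuous_boundary[OF _ dom \<sigma>] C1_with_grad_continuous[OF \<phi>] C1_with_grad_continuous[OF \<psi>])+
  have N1: "norm (r * (boundary_normal \<Omega> x \<bullet> e)) \<le> norm r" for r x
    using order_trans[OF Basis_le_norm[OF e] norm_boundary_normal_le[OF dom, of x]]
    by (simp add: abs_mult mult_left_le)
  have times_N: "L2_fun \<sigma> (\<lambda>x. q x * (boundary_normal \<Omega> x \<bullet> e))"
    "L2_norm \<sigma> (\<lambda>x. q x * (boundary_normal \<Omega> x \<bullet> e)) \<le> L2_norm \<sigma> q" if "L2_fun \<sigma> q" for q
    using L2_fun_measurable[OF that] N1 by (auto intro!: L2_fun_bound[OF that])
  \<comment> \<open>The divergence theorem for the approximating products \<open>\<phi> k * \<psi> k\<close>.\<close>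
  have eq: "L2_inner ?M (\<phi> k) (\<lambda>x. h k x \<bullet> e) + L2_inner ?M (\<psi> k) (\<lambda>x. g k x \<bullet> e) =
      L2_inner \<sigma> (\<phi> k) (\<lambda>x. \<psi> k x * (boundary_normal \<Omega> x \<bullet> e))" for k
  proof -
    have "L2_inner ?M (\<phi> k) (\<lambda>x. h k x \<bullet> e) + L2_inner ?M (\<psi> k) (\<lambda>x. g k x \<bullet> e) =
        (\<integral>x. \<phi> k x \<bullet> (h k x \<bullet> e) + \<psi> k x \<bullet> (g k x \<bullet> e) \<partial>?M)"
      unfolding L2_inner_def
      by (intro Bochner_Integration.integral_add[symmetric] integrable_L2_inner L2M L2_fun_component e1)
    also have "\<dots> = (\<integral>x. (\<phi> k x *\<^sub>R h k x + \<psi> k x *\<^sub>R g k x) \<bullet> e \<partial>?M)"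
      by (simp add: inner_add_left)
    also have "\<dots> = (\<integral>x. indicator \<Omega> x * ((\<phi> k x *\<^sub>R h k x + \<psi> k x *\<^sub>R g k x) \<bullet> e) \<partial>lborel)"
      by (rule integral_lebesgue_on_eq_lborel) measurable
    also have "\<dots> = (\<integral>x. \<phi> k x * \<psi> k x * (boundary_normal \<Omega> x \<bullet> e) \<partial>\<sigma>)"
      by (rule divergence_theorem[OF dom \<sigma> C1_with_grad_mult[OF \<phi> \<psi>] e])
    finally show ?thesis
      by (simp add: L2_inner_def mult.assoc)
  qed
  have "(\<lambda>k. L2_inner ?M (\<phi> k) (\<lambda>x. h k x \<bullet> e) + L2_inner ?M (\<psi> k) (\<lambda>x. g k x \<bullet> e))
    \<longlonglongrightarrow> L2_inner ?M v (\<lambda>x. weak_grad \<Omega> w x \<bullet> e) + L2_inner ?M w (\<lambda>x. weak_grad \<Omega> v x \<bullet> e)"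
    by (intro tendsto_add tendsto_L2_inner always_eventually allI L2M L2_fun_component e1
        H1_L2_fun v' w' \<phi>_lim \<psi>_lim tendsto_L2_norm_component)
  moreover have "(\<lambda>k. L2_norm \<sigma> (\<lambda>x. \<psi> k x * (boundary_normal \<Omega> x \<bullet> e) - \<delta> x * (boundary_normal \<Omega> x \<bullet> e)))
      \<longlonglongrightarrow> 0"
  proof (rule Lim_null_comparison[OF _ \<psi>_lim(3)], rule always_eventually, rule allI)
    fix k
    show "norm (L2_norm \<sigma> (\<lambda>x. \<psi> k x * (boundary_normal \<Omega> x \<bullet> e) - \<delta> x * (boundary_normal \<Omega> x \<bullet> e)))
        \<le> L2_norm \<sigma> (\<lambda>x. \<psi> k x - \<delta> x)"
      using times_N(2)[OF L2_fun_diff[OF L2\<sigma>(2) w'(2)], of k] by (simp add: left_diff_distrib)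
  qed
  then have "(\<lambda>k. L2_inner \<sigma> (\<phi> k) (\<lambda>x. \<psi> k x * (boundary_normal \<Omega> x \<bullet> e)))
    \<longlonglongrightarrow> L2_inner \<sigma> \<gamma> (\<lambda>x. \<delta> x * (boundary_normal \<Omega> x \<bullet> e))"
    by (intro tendsto_L2_inner always_eventually allI L2\<sigma> times_N v' w' \<phi>_lim)
  ultimately show ?thesis
    unfolding eq by (rule LIMSEQ_unique)
qed

text \<open>Integration by parts is applied to \<open>v\<close> and its partial derivative in the direction \<open>i\<close>, and the results
  are summed over the basis. The normal derivative is replaced by a measurable function \<open>q\<close> that agrees
  with it almost everywhere, such as the prescribed boundary flux.\<close>

lemma green_identity:
  fixes \<Omega> :: "'a::euclidean_space set"
  assumes dom: "bounded_smooth_domain \<Omega>" and \<sigma>: "is_surface_measure \<Omega> \<sigma>"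
    and v: "v \<in> H2 \<Omega>" "has_trace \<Omega> \<sigma> v \<gamma>"
    and traces: "\<And>i. i \<in> Basis \<Longrightarrow> \<exists>\<gamma>. has_trace \<Omega> \<sigma> (weak_partial \<Omega> i v) \<gamma>"
    and q: "AE x in \<sigma>. normal_derivative \<Omega> \<sigma> v x = q x" "q \<in> borel_measurable \<sigma>"
  shows "L2_fun (lebesgue_on \<Omega>) (weak_laplacian \<Omega> v)"
    "L2_inner (lebesgue_on \<Omega>) v (weak_laplacian \<Omega> v) + (L2_norm (lebesgue_on \<Omega>) (weak_grad \<Omega> v))\<^sup>2 =
       (\<integral>x. \<gamma> x * q x \<partial>\<sigma>)"
    "integrable \<sigma> (\<lambda>x. \<gamma> x * q x)"
proof -
  let ?M = "lebesgue_on \<Omega>"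
  let ?\<delta> = "\<lambda>i. boundary_trace \<Omega> \<sigma> (weak_partial \<Omega> i v)"
  let ?N = "boundary_normal \<Omega>"
  have s[measurable_cong]: "sets \<sigma> = sets borel"
    using \<sigma> by (simp add: is_surface_measure_def)
  have vH1: "v \<in> H1 \<Omega>" "\<And>i. i \<in> Basis \<Longrightarrow> weak_partial \<Omega> i v \<in> H1 \<Omega>"
    using v(1) by (auto simp: H2_def)
  have \<delta>: "has_trace \<Omega> \<sigma> (weak_partial \<Omega> i v) (?\<delta> i)" if "i \<in> Basis" for i
    using traces[OF that] boundary_trace_has_trace by blast
  have \<gamma>L2: "L2_fun \<sigma> \<gamma>" and \<delta>L2: "\<And>i. i \<in> Basis \<Longrightarrow> L2_fun \<sigma> (?\<delta> i)"
    using v(2) \<delta> by (auto simp: has_trace_def)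
  note [measurable] = boundary_normal_measurable[OF dom] q(2) \<gamma>L2[THEN L2_fun_measurable]
    \<delta>L2[THEN L2_fun_measurable]
  have L2_dd: "L2_fun ?M (\<lambda>x. weak_grad \<Omega> (weak_partial \<Omega> i v) x \<bullet> i)" if "i \<in> Basis" for i
    using that by (intro L2_fun_component H1_L2_fun vH1) auto
  have "L2_fun ?M (\<lambda>x. \<Sum>i\<in>S. weak_grad \<Omega> (weak_partial \<Omega> i v) x \<bullet> i)" if "finite S" "S \<subseteq> Basis" for S
    using that
    by (induction S rule: finite_induct) (auto intro!: L2_fun_add L2_dd simp: L2_fun_def[of _ "\<lambda>x. 0"])
  then show "L2_fun ?M (weak_laplacian \<Omega> v)"
    by (simp add: weak_laplacian_def weak_partial_def[of \<Omega> _ "weak_partial \<Omega> _ v"])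
  have \<delta>N: "L2_fun \<sigma> (\<lambda>x. ?\<delta> i x * (?N x \<bullet> i))" if i: "i \<in> Basis" for i
  proof (rule L2_fun_bound[OF \<delta>L2[OF i]])
    show "AE x in \<sigma>. norm (?\<delta> i x * (?N x \<bullet> i)) \<le> norm (?\<delta> i x)"
      using order_trans[OF Basis_le_norm[OF i] norm_boundary_normal_le[OF dom]]
      by (simp add: abs_mult mult_left_le)
  qed (use i in measurable)
  have ae: "AE x in \<sigma>. (\<Sum>i\<in>Basis. \<gamma> x * (?\<delta> i x * (?N x \<bullet> i))) = \<gamma> x * q x"
    using q(1) AE_frontier[OF \<sigma>]
    by eventually_elim (simp add: normal_derivative_def boundary_normal_def flip: sum_distrib_left)
  have int: "integrable \<sigma> (\<lambda>x. \<gamma> x * (?\<delta> i x * (?N x \<bullet> i)))" if "i \<in> Basis" for i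
    using integrable_L2_inner[OF \<gamma>L2 \<delta>N[OF that]] by simp
  have "integrable \<sigma> (\<lambda>x. \<Sum>i\<in>Basis. \<gamma> x * (?\<delta> i x * (?N x \<bullet> i)))"
    by (intro Bochner_Integration.integrable_sum int)
  then show "integrable \<sigma> (\<lambda>x. \<gamma> x * q x)"
    by (rule integrable_cong_AE_imp) (use ae in auto)
  have "L2_inner ?M v (weak_laplacian \<Omega> v) =
      (\<Sum>i\<in>Basis. L2_inner ?M v (\<lambda>x. weak_grad \<Omega> (weak_partial \<Omega> i v) x \<bullet> i))"
    unfolding L2_inner_def weak_laplacian_def weak_partial_def[of \<Omega> _ "weak_partial \<Omega> _ v"] inner_sum_right
    by (intro Bochner_Integration.integral_sum integrable_L2_inner H1_L2_fun vH1 L2_dd)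
  moreover have "(L2_norm ?M (weak_grad \<Omega> v))\<^sup>2 =
      (\<Sum>i\<in>Basis. L2_inner ?M (weak_partial \<Omega> i v) (\<lambda>x. weak_grad \<Omega> v x \<bullet> i))"
    unfolding L2_norm_square L2_inner_def
    by (subst euclidean_inner, subst Bochner_Integration.integral_sum)
       (auto simp: weak_partial_def intro!: integrable_L2_inner[where 'b = real, simplified] L2_fun_component
          H1_L2_fun(2)[OF vH1(1)])
  ultimately have "L2_inner ?M v (weak_laplacian \<Omega> v) + (L2_norm ?M (weak_grad \<Omega> v))\<^sup>2 =
     (\<Sum>i\<in>Basis. L2_inner \<sigma> \<gamma> (\<lambda>x. ?\<delta> i x * (?N x \<bullet> i)))"
    using integration_by_parts_traces[OF dom \<sigma> v(2) \<delta>] by (simp flip: sum.distrib)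
  also have "\<dots> = (\<integral>x. (\<Sum>i\<in>Basis. \<gamma> x * (?\<delta> i x * (?N x \<bullet> i))) \<partial>\<sigma>)"
    unfolding L2_inner_def
    by (subst Bochner_Integration.integral_sum) (auto intro!: int)
  also have "\<dots> = (\<integral>x. \<gamma> x * q x \<partial>\<sigma>)"
    using ae by (intro integral_cong_AE) auto
  finally show "L2_inner ?M v (weak_laplacian \<Omega> v) + (L2_norm ?M (weak_grad \<Omega> v))\<^sup>2 =
       (\<integral>x. \<gamma> x * q x \<partial>\<sigma>)" .
qed

section \<open>The concavity method\<close>

lemma time_interval_interior:
  assumes "t \<in> time_interval T" "0 < t"
  shows "at t within time_interval T = at t"
proof -
  have "open {s. ereal s < T}"
    using open_Collect_less[of ereal "\<lambda>_. T"] by (simp add: continuous_on_ereal)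
  then have "open ({0<..} \<inter> {s. ereal s < T})"
    by (intro open_Int open_greaterThan)
  moreover have "{0<..} \<inter> {s. ereal s < T} \<subseteq> time_interval T"
    by (auto simp: time_interval_def)
  ultimately have "t \<in> interior (time_interval T)"
    using assms by (intro interiorI) (auto simp: time_interval_def)
  then show ?thesis
    by (rule at_within_interior)
qed

lemma time_interval_downward:
  "t \<in> time_interval T \<Longrightarrow> 0 \<le> s \<Longrightarrow> s \<le> t \<Longrightarrow> s \<in> time_interval T"
  unfolding time_interval_def by (auto intro: le_less_trans[of "ereal s" "ereal t"])

text \<open>Levine's concavity method. With \<open>y = \<Psi> powr (- \<alpha>)\<close> the differential inequality says
  \<open>y'' \<le> 2 \<alpha> (1 + 2 \<alpha>) K y powr (1 + 1 / \<alpha>)\<close>. The initial condition \<open>(\<Psi>' 0)\<^sup>2 > 4 K \<Psi> 0\<close> says that \<open>y\<close> starts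
  with more speed towards \<open>0\<close> than the right-hand side can brake, and so \<open>y\<close> reaches \<open>0\<close>.\<close>

locale concavity_inequality =
  fixes T :: ereal and \<Psi> \<Psi>' \<Psi>'' :: "real \<Rightarrow> real" and \<alpha> K :: real
  assumes T: "0 < T" and \<alpha>: "\<alpha> > 0" and K: "K > 0"
    and deriv: "\<And>t. t \<in> time_interval T \<Longrightarrow> (\<Psi> has_real_derivative \<Psi>' t) (at t within time_interval T)"
      "\<And>t. t \<in> time_interval T \<Longrightarrow> (\<Psi>' has_real_derivative \<Psi>'' t) (at t within time_interval T)"
    and concavity: "\<And>t. t \<in> time_interval T \<Longrightarrow>
      \<Psi> t * \<Psi>'' t - (1 + \<alpha>) * (\<Psi>' t)\<^sup>2 \<ge> - 2 * (1 + 2 * \<alpha>) * K * \<Psi> t"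
    and initial: "\<Psi> 0 > 0" "\<Psi>' 0 > 0" "(\<Psi>' 0)\<^sup>2 > 4 * K * \<Psi> 0"
begin

text \<open>Where equality holds in the differential inequality, this quantity is constant in time. Up to the
  factor \<open>\<alpha>\<^sup>2\<close> it is \<open>y'\<^sup>2 - 4 \<alpha>\<^sup>2 K y powr (2 + 1 / \<alpha>)\<close> for \<open>y = \<Psi> powr (- \<alpha>)\<close>, twice the energy of the
  Newtonian equation \<open>y'' = 2 \<alpha> (1 + 2 \<alpha>) K y powr (1 + 1 / \<alpha>)\<close>.\<close>

definition first_integral :: "real \<Rightarrow> real" where
  "first_integral t = \<Psi> t powr (- 2 * \<alpha> - 2) * ((\<Psi>' t)\<^sup>2 - 4 * K * \<Psi> t)"

lemma first_integral_0_pos: "first_integral 0 > 0"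
  using initial by (simp add: first_integral_def)

lemma continuous_on_interval:
  assumes "t \<in> time_interval T"
  shows "continuous_on {0..t} \<Psi>" "continuous_on {0..t} \<Psi>'"
proof -
  have "{0..t} \<subseteq> time_interval T"
    using time_interval_downward[OF assms] by auto
  then show "continuous_on {0..t} \<Psi>" "continuous_on {0..t} \<Psi>'"
    using DERIV_continuous_on[OF deriv(1)] DERIV_continuous_on[OF deriv(2)]
    by (blast intro: continuous_on_subset)+
qed

lemma deriv_interior:
  assumes "t \<in> time_interval T" "0 < t"
  shows "(\<Psi> has_real_derivative \<Psi>' t) (at t)" "(\<Psi>' has_real_derivative \<Psi>'' t) (at t)"
  using deriv[OF assms(1)] by (simp_all add: time_interval_interior[OF assms])

text \<open>Positivity of \<open>\<Psi>'\<close> is assumed only in the open interval, because the lemma is used to prove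
  positivity at the right endpoint.\<close>

lemma Psi_mono:
  assumes t: "t \<in> time_interval T" and s: "0 \<le> s" "s \<le> t"
    and pos: "\<And>r. 0 < r \<Longrightarrow> r < t \<Longrightarrow> \<Psi>' r > 0"
  shows "\<Psi> s \<le> \<Psi> t"
proof (rule DERIV_nonneg_imp_increasing_open[OF s(2)])
  fix x assume "s < x" "x < t"
  then show "\<exists>y. (\<Psi> has_real_derivative y) (at x) \<and> 0 \<le> y"
    using deriv_interior(1)[of x] time_interval_downward[OF t, of x] pos[of x] s(1)
    by (intro exI[of _ "\<Psi>' x"]) auto
qed (use continuous_on_interval(1)[OF t] s in \<open>auto intro: continuous_on_subset\<close>)

lemma first_integral_mono:
  assumes t: "t \<in> time_interval T" and pos: "\<And>r. 0 < r \<Longrightarrow> r < t \<Longrightarrow> \<Psi>' r > 0"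
  shows "first_integral 0 \<le> first_integral t"
proof -
  have t0: "0 \<le> t"
    using t by (simp add: time_interval_def)
  have \<Psi>: "\<Psi> s > 0" if "0 \<le> s" "s \<le> t" for s
    using Psi_mono[of s 0] time_interval_downward[OF t that] pos that initial(1) by fastforce
  have "continuous_on {0..t} first_integral"
    unfolding first_integral_def using \<Psi>
    by (intro continuous_intros continuous_on_interval[OF t]) force
  then show ?thesis
  proof (rule DERIV_nonneg_imp_increasing_open[OF t0, rotated])
    fix x assume x: "0 < x" "x < t"
    then have xI: "x \<in> time_interval T"
      using time_interval_downward[OF t] by simp
    note d = deriv_interior[OF xI x(1)]
    have P: "\<Psi> x > 0"
      using \<Psi> x by simp
    define r where "r = - 2 * \<alpha> - 2"
    define p where "p = \<Psi> x powr (r - 1)"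
    have pr: "\<Psi> x powr r = p * \<Psi> x"
      using P by (simp add: p_def powr_diff)
    have "(first_integral has_real_derivative (r * p * \<Psi>' x) * ((\<Psi>' x)\<^sup>2 - 4 * K * \<Psi> x)
        + (2 * \<Psi>' x * \<Psi>'' x - 4 * K * \<Psi>' x) * \<Psi> x powr r) (at x)"
      unfolding first_integral_def r_def[symmetric] p_def
      by (rule DERIV_mult[OF DERIV_fun_powr[OF d(1) P, of r, simplified]])
         (auto intro!: derivative_eq_intros d)
    \<comment> \<open>The derivative is a nonnegative multiple of the expression that the differential inequality controls.\<close>
    moreover have "(r * p * \<Psi>' x) * ((\<Psi>' x)\<^sup>2 - 4 * K * \<Psi> x)
        + (2 * \<Psi>' x * \<Psi>'' x - 4 * K * \<Psi>' x) * \<Psi> x powr r =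
      2 * p * \<Psi>' x * (\<Psi> x * \<Psi>'' x - (1 + \<alpha>) * (\<Psi>' x)\<^sup>2 + 2 * (1 + 2 * \<alpha>) * K * \<Psi> x)"
      unfolding pr unfolding r_def by (simp add: power2_eq_square algebra_simps)
    moreover have "0 \<le> \<dots>"
    proof (intro mult_nonneg_nonneg)
      show "0 \<le> \<Psi> x * \<Psi>'' x - (1 + \<alpha>) * (\<Psi>' x)\<^sup>2 + 2 * (1 + 2 * \<alpha>) * K * \<Psi> x"
        using concavity[OF xI] by linarith
    qed (use pos[OF x] in \<open>auto simp: p_def\<close>)
    ultimately show "\<exists>y. (first_integral has_real_derivative y) (at x) \<and> 0 \<le> y"
      by metis
  qed
qed

lemma Psi'_pos:
  assumes t: "t \<in> time_interval T"
  shows "\<Psi>' t > 0"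
proof (rule ccontr)
  assume neg: "\<not> \<Psi>' t > 0"
  have t0: "0 \<le> t"
    using t by (simp add: time_interval_def)
  \<comment> \<open>The first zero of \<open>\<Psi>'\<close>: up to it the first integral has not decreased, yet there it would be negative.\<close>
  define Z where "Z = {s \<in> {0..t}. \<Psi>' s = 0}"
  have "closed Z"
    unfolding Z_def
    using continuous_closed_preimage_constant[OF continuous_on_interval(2)[OF t]] by simp
  moreover have "bounded Z"
    by (rule bounded_subset[OF bounded_closed_interval[of 0 t]]) (auto simp: Z_def)
  ultimately have "compact Z"
    by (simp add: compact_eq_bounded_closed)
  moreover have "Z \<noteq> {}"
    using IVT2'[of \<Psi>' t 0 0] neg initial(2) t0 continuous_on_interval(2)[OF t] by (auto simp: Z_def)
  ultimately obtain z where z: "z \<in> Z" "\<And>s. s \<in> Z \<Longrightarrow> z \<le> s"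
    using compact_attains_inf by metis
  have zI: "z \<in> time_interval T" and z0: "0 \<le> z" "z \<le> t" "\<Psi>' z = 0"
    using z(1) time_interval_downward[OF t] by (auto simp: Z_def)
  have pos: "\<Psi>' r > 0" if r: "0 < r" "r < z" for r
  proof (rule ccontr)
    assume "\<not> \<Psi>' r > 0"
    moreover have "continuous_on {0..r} \<Psi>'"
      using r z0 continuous_on_subset[OF continuous_on_interval(2)[OF t]] by auto
    ultimately obtain s where "0 \<le> s" "s \<le> r" "\<Psi>' s = 0"
      using IVT2'[of \<Psi>' r 0 0] initial(2) r by auto
    then have "s \<in> Z"
      using r z0 by (auto simp: Z_def)
    from z(2)[OF this] show False
      using \<open>s \<le> r\<close> r by simp
  qed
  have "0 < first_integral z"
    using first_integral_mono[OF zI pos] first_integral_0_pos by simp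
  moreover have "\<Psi> z > 0"
    using Psi_mono[OF zI order_refl z0(1) pos] initial(1) by simp
  ultimately show False
    using K z0(3) by (simp add: first_integral_def zero_less_mult_iff mult_less_0_iff)
qed

lemma Psi_monotone:
  assumes "t \<in> time_interval T" "0 \<le> s" "s \<le> t"
  shows "\<Psi> s \<le> \<Psi> t"
  using assms Psi'_pos time_interval_downward[OF assms(1)] by (intro Psi_mono) auto

lemma Psi_pos: "t \<in> time_interval T \<Longrightarrow> \<Psi> t > 0"
  using Psi_monotone[of t 0] initial(1) by (fastforce simp: time_interval_def)

text \<open>Dropping the negative term \<open>- 4 K \<Psi>\<close> from the first integral leaves a superlinear differential
  inequality for \<open>\<Psi>\<close>, whose positive solutions cannot be global.\<close>

lemma Psi'_lower_bound:
  assumes t: "t \<in> time_interval T"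
  shows "sqrt (first_integral 0) * \<Psi> t powr (\<alpha> + 1) \<le> \<Psi>' t"
proof (rule power2_le_imp_le)
  have "first_integral 0 \<le> first_integral t"
    using t Psi'_pos time_interval_downward[OF t] by (intro first_integral_mono) auto
  also have "\<dots> \<le> \<Psi> t powr (- 2 * \<alpha> - 2) * (\<Psi>' t)\<^sup>2"
    unfolding first_integral_def using Psi_pos[OF t] K by (intro mult_left_mono) (auto simp: less_imp_le)
  finally have "first_integral 0 * \<Psi> t powr (2 * \<alpha> + 2) \<le>
      \<Psi> t powr (- 2 * \<alpha> - 2) * (\<Psi>' t)\<^sup>2 * \<Psi> t powr (2 * \<alpha> + 2)"
    by (intro mult_right_mono) auto
  also have "\<dots> = (\<Psi>' t)\<^sup>2 * \<Psi> t powr ((- 2 * \<alpha> - 2) + (2 * \<alpha> + 2))"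
    unfolding powr_add by simp
  also have "\<dots> = (\<Psi>' t)\<^sup>2"
    using Psi_pos[OF t] by simp
  finally have "first_integral 0 * \<Psi> t powr (2 * \<alpha> + 2) \<le> (\<Psi>' t)\<^sup>2" .
  moreover have "(\<Psi> t powr (\<alpha> + 1))\<^sup>2 = \<Psi> t powr (2 * \<alpha> + 2)"
    unfolding power2_eq_square powr_add[symmetric] by (simp add: algebra_simps)
  ultimately show "(sqrt (first_integral 0) * \<Psi> t powr (\<alpha> + 1))\<^sup>2 \<le> (\<Psi>' t)\<^sup>2"
    using first_integral_0_pos by (simp add: power_mult_distrib)
qed (use Psi'_pos[OF t] in simp)

text \<open>The function \<open>\<Psi> powr (- \<alpha>)\<close> is positive and decreases at a speed of at least
  \<open>\<alpha> * sqrt (first_integral 0)\<close>, which exhausts its initial value in finite time.\<close>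

lemma time_bound:
  assumes t: "t \<in> time_interval T"
  shows "\<alpha> * sqrt (first_integral 0) * t \<le> \<Psi> 0 powr (- \<alpha>)"
proof -
  have t0: "0 \<le> t"
    using t by (simp add: time_interval_def)
  let ?y = "\<lambda>s. \<Psi> s powr (- \<alpha>) + \<alpha> * sqrt (first_integral 0) * s"
  have "?y t \<le> ?y 0"
  proof (rule DERIV_nonpos_imp_decreasing_open[OF t0])
    fix x assume x: "0 < x" "x < t"
    then have xI: "x \<in> time_interval T"
      using time_interval_downward[OF t] by simp
    have P: "\<Psi> x > 0"
      by (rule Psi_pos[OF xI])
    have "(?y has_real_derivative - \<alpha> * \<Psi> x powr (- \<alpha> - 1) * \<Psi>' x + \<alpha> * sqrt (first_integral 0)) (at x)"
      using DERIV_add[OF DERIV_fun_powr[OF deriv_interior(1)[OF xI x(1)] P, of "- \<alpha>"]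
          DERIV_cmult_Id[of "\<alpha> * sqrt (first_integral 0)"]]
      by simp
    moreover have "\<Psi> x powr (- \<alpha> - 1) * (sqrt (first_integral 0) * \<Psi> x powr (\<alpha> + 1)) \<le> \<Psi> x powr (- \<alpha> - 1) * \<Psi>' x"
      by (intro mult_left_mono Psi'_lower_bound[OF xI]) simp
    then have "sqrt (first_integral 0) * \<Psi> x powr ((- \<alpha> - 1) + (\<alpha> + 1)) \<le> \<Psi> x powr (- \<alpha> - 1) * \<Psi>' x"
      unfolding powr_add by (simp only: mult.left_commute)
    then have "\<alpha> * sqrt (first_integral 0) \<le> \<alpha> * (\<Psi> x powr (- \<alpha> - 1) * \<Psi>' x)"
      using P \<alpha> by simp
    then have "- \<alpha> * \<Psi> x powr (- \<alpha> - 1) * \<Psi>' x + \<alpha> * sqrt (first_integral 0) \<le> 0"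
      by simp
    ultimately show "\<exists>y. (?y has_real_derivative y) (at x) \<and> y \<le> 0"
      by blast
  next
    show "continuous_on {0..t} ?y"
      using Psi_pos time_interval_downward[OF t]
      by (intro continuous_intros continuous_on_interval[OF t]) force
  qed
  moreover have "0 \<le> \<Psi> t powr (- \<alpha>)"
    by simp
  ultimately show ?thesis
    by (simp del: powr_ge_zero)
qed

lemma finite_time: "T < \<infinity>"
proof (rule ccontr)
  assume "\<not> T < \<infinity>"
  then have T: "T = \<infinity>"
    by simp
  define c where "c = \<alpha> * sqrt (first_integral 0)"
  have c: "c > 0"
    using \<alpha> first_integral_0_pos by (simp add: c_def)
  define t where "t = (\<Psi> 0 powr (- \<alpha>) + 1) / c"
  have "t \<in> time_interval T"
    using c T by (simp add: t_def time_interval_def add_nonneg_nonneg)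
  from time_bound[OF this] show False
    using c by (simp add: t_def flip: c_def)
qed

text \<open>A nondecreasing function tends to its supremum.\<close>

lemma blow_up:
  assumes unbounded: "\<not> bdd_above (\<Psi> ` time_interval T)"
  shows "filterlim \<Psi> at_top (at_left (real_of_ereal T))"
proof -
  obtain \<tau> where \<tau>: "T = ereal \<tau>"
    using finite_time T by (cases T) auto
  show ?thesis
    unfolding filterlim_at_top
  proof
    fix c
    obtain s where s: "s \<in> time_interval T" "c < \<Psi> s"
      using unbounded by (force simp: bdd_above_def not_le)
    have "s < \<tau>"
      using s(1) \<tau> by (simp add: time_interval_def)
    then have "\<forall>\<^sub>F t in at_left \<tau>. t \<in> {s<..<\<tau>}"
      by (rule eventually_at_left_real)
    then show "\<forall>\<^sub>F t in at_left (real_of_ereal T). c \<le> \<Psi> t"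
      unfolding \<tau> real_of_ereal.simps
    proof eventually_elim
      case (elim t)
      then have "\<Psi> s \<le> \<Psi> t"
        using s(1) \<tau> by (intro Psi_monotone) (auto simp: time_interval_def)
      then show ?case
        using s(2) by simp
    qed
  qed
qed

end

section \<open>Blow-up of strong solutions\<close>

lemma L2_inner_wave_equation:
  fixes v a l :: "'a::euclidean_space \<Rightarrow> real"
  assumes \<Omega>: "\<Omega> \<in> sets lebesgue"
    and v: "L2_fun (lebesgue_on \<Omega>) v" and a: "L2_fun (lebesgue_on \<Omega>) a" and l: "L2_fun (lebesgue_on \<Omega>) l"
    and eq: "AE x in lebesgue_on \<Omega>. a x - l x + b * v x = 0"
  shows "L2_inner (lebesgue_on \<Omega>) v a = L2_inner (lebesgue_on \<Omega>) v l - b * (L2_norm (lebesgue_on \<Omega>) v)\<^sup>2"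
proof -
  let ?M = "lebesgue_on \<Omega>"
  have bv: "L2_fun ?M (\<lambda>x. b *\<^sub>R v x)"
    by (rule L2_fun_scaleR[OF v])
  have "AE x in ?M. a x = l x - b *\<^sub>R v x"
    using eq by eventually_elim simp
  then have "L2_inner ?M v a = L2_inner ?M v (\<lambda>x. l x - b *\<^sub>R v x)"
    using v a by (intro L2_inner_cong_AE_lebesgue_on[OF \<Omega>]) (simp_all add: L2_fun_def)
  also have "\<dots> = L2_inner ?M v l - L2_inner ?M v (\<lambda>x. b *\<^sub>R v x)"
    by (rule L2_inner_diff_right[OF l bv v])
  also have "L2_inner ?M v (\<lambda>x. b *\<^sub>R v x) = b * (L2_norm ?M v)\<^sup>2"
    by (simp only: L2_inner_scaleR_right L2_norm_square)
  finally show ?thesis .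
qed

text \<open>The constant \<open>r0\<close> contributes its integral over the whole boundary, whose measure is finite.\<close>

lemma boundary_growth:
  fixes \<Omega> :: "'a::euclidean_space set" and f F :: "real \<Rightarrow> real"
  assumes dom: "bounded_smooth_domain \<Omega>" and \<sigma>: "is_surface_measure \<Omega> \<sigma>"
    and growth: "\<And>s. f s * s - c * F s \<ge> - r0"
    and int: "integrable \<sigma> (\<lambda>x. \<gamma> x * f (\<gamma> x))" "integrable \<sigma> (\<lambda>x. F (\<gamma> x))"
  shows "(\<integral>x. \<gamma> x * f (\<gamma> x) \<partial>\<sigma>) \<ge> c * (\<integral>x. F (\<gamma> x) \<partial>\<sigma>) - measure \<sigma> (frontier \<Omega>) * r0"
proof -
  interpret finite_measure \<sigma>
    by (rule finite_surface_measure[OF dom \<sigma>])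
  have s: "sets \<sigma> = sets borel"
    using \<sigma> by (simp add: is_surface_measure_def)
  have "measure \<sigma> (space \<sigma>) = measure \<sigma> (frontier \<Omega>)"
    using AE_frontier[OF \<sigma>] s by (intro finite_measure_eq_AE) auto
  then have "c * (\<integral>x. F (\<gamma> x) \<partial>\<sigma>) - measure \<sigma> (frontier \<Omega>) * r0 = (\<integral>x. c * F (\<gamma> x) - r0 \<partial>\<sigma>)"
    using int by simp
  also have "\<dots> \<le> (\<integral>x. \<gamma> x * f (\<gamma> x) \<partial>\<sigma>)"
  proof (rule integral_mono)
    show "c * F (\<gamma> x) - r0 \<le> \<gamma> x * f (\<gamma> x)" for x
      using growth[of "\<gamma> x"] by (simp add: mult.commute)
  qed (use int in auto)
  finally show ?thesis .
qed

theorem theorem4p1: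
  fixes \<Omega> :: "'a::euclidean_space set" and \<sigma> :: "'a measure"
    and b \<alpha> r0 R0 E0 :: real and f :: "real \<Rightarrow> real"
    and u0 u1 :: "'a \<Rightarrow> real" and T :: ereal
    and u ut utt :: "real \<Rightarrow> 'a \<Rightarrow> real"
  assumes domain: "bounded_smooth_domain \<Omega>"
    and surface: "is_surface_measure \<Omega> \<sigma>"
    and b: "b > 0"
    and f_cont: "continuous_on UNIV f"
    and \<alpha>: "\<alpha> > 0" and r0: "r0 \<ge> 0"
    and f_growth: "\<And>s. f s * s - 2 * (1 + 2 * \<alpha>) * primitive f s \<ge> - r0"
    and solution: "strong_solution \<Omega> \<sigma> b f u0 u1 T u ut utt"
    and maximal: "\<not> extendable \<Omega> \<sigma> b f u0 u1 T u"
    and continuation: "T < \<infinity> \<Longrightarrow>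
          bounded ((\<lambda>t. L2_norm (lebesgue_on \<Omega>) (u t)) ` time_interval T) \<Longrightarrow>
          extendable \<Omega> \<sigma> b f u0 u1 T u"
    and R0: "R0 = measure \<sigma> (frontier \<Omega>) * r0"
    and E0: "E0 = energy \<Omega> \<sigma> b f u0 u1"
    and energy_eq: "\<And>t. t \<in> time_interval T \<Longrightarrow>
          integrable \<sigma> (\<lambda>x. primitive f (boundary_trace \<Omega> \<sigma> (u t) x)) \<and>
          energy \<Omega> \<sigma> b f (u t) (ut t) = E0"
    and u0_nonzero: "\<not> (AE x in lebesgue_on \<Omega>. u0 x = 0)"
    and inner_pos: "L2_inner (lebesgue_on \<Omega>) u0 u1 > 0"
    and data: "(L2_inner (lebesgue_on \<Omega>) u0 u1)\<^sup>2 / (L2_norm (lebesgue_on \<Omega>) u0)\<^sup>2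
                 > 2 * E0 + R0 / (1 + 2 * \<alpha>)"
    and data_pos: "2 * E0 + R0 / (1 + 2 * \<alpha>) > 0"
  shows "T < \<infinity> \<and>
         filterlim (\<lambda>t. (L2_norm (lebesgue_on \<Omega>) (u t))\<^sup>2) at_top (at_left (real_of_ereal T))"
proof -
  let ?M = "lebesgue_on \<Omega>" and ?I = "time_interval T"
  define K where "K = 2 * E0 + R0 / (1 + 2 * \<alpha>)"
  define A where "A t = (L2_norm ?M (u t))\<^sup>2" for t
  define B where "B t = L2_inner ?M (u t) (ut t)" for t
  define C where "C t = (L2_norm ?M (ut t))\<^sup>2 + L2_inner ?M (u t) (utt t)" for t
  have "open \<Omega>"
    using domain by (simp add: bounded_smooth_domain_def)
  then have \<Omega>: "\<Omega> \<in> sets lebesgue"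
    by (simp add: borel_open)
  have T: "0 < T" and reg: "strong_regularity \<Omega> T u ut utt"
    and init: "AE x in ?M. u 0 x = u0 x" "AE x in ?M. ut 0 x = u1 x"
    using solution by (auto simp: strong_solution_def)
  have wave: "AE x in ?M. utt t x - weak_laplacian \<Omega> (u t) x + b * u t x = 0"
    and trace: "\<exists>\<gamma>. has_trace \<Omega> \<sigma> (u t) \<gamma>"
    and traces: "\<And>i. i \<in> Basis \<Longrightarrow> \<exists>\<gamma>. has_trace \<Omega> \<sigma> (weak_partial \<Omega> i (u t)) \<gamma>"
    and flux: "AE x in \<sigma>. normal_derivative \<Omega> \<sigma> (u t) x = f (boundary_trace \<Omega> \<sigma> (u t) x)"
    if "t \<in> ?I" for t
    using solution that unfolding strong_solution_def by blast+
  have H2: "u t \<in> H2 \<Omega>" if "t \<in> ?I" for t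
    using reg that by (simp add: strong_regularity_def Let_def)
  have du: "L2_has_derivative ?I ?M u ut" and dut: "L2_has_derivative ?I ?M ut utt"
    and cu: "L2_continuous ?I ?M u" and cut: "L2_continuous ?I ?M ut"
    using reg by (simp_all add: strong_regularity_def Let_def)
  have L2: "L2_fun ?M (u t)" "L2_fun ?M (ut t)" "L2_fun ?M (utt t)" if "t \<in> ?I" for t
    using du dut that by (simp_all add: L2_has_derivative_def)
  have zero: "0 \<in> ?I"
    using T by (simp add: time_interval_def zero_ereal_def)

  \<comment> \<open>Test the equation with \<open>u t\<close>, then use the growth condition to trade the boundary term for the
    potential energy, which the energy equality expresses through the other norms.\<close>
  have accel: "4 * (1 + \<alpha>) * (L2_norm ?M (ut t))\<^sup>2 - 2 * (1 + 2 * \<alpha>) * K \<le> 2 * C t" if t: "t \<in> ?I" for t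
  proof -
    let ?\<gamma> = "boundary_trace \<Omega> \<sigma> (u t)" and ?G = "(L2_norm ?M (weak_grad \<Omega> (u t)))\<^sup>2"
    let ?F = "\<integral>x. primitive f (?\<gamma> x) \<partial>\<sigma>" and ?J = "\<integral>x. ?\<gamma> x * f (?\<gamma> x) \<partial>\<sigma>"
    have \<gamma>: "has_trace \<Omega> \<sigma> (u t) ?\<gamma>"
      using trace[OF t] boundary_trace_has_trace by blast
    have "?\<gamma> \<in> borel_measurable \<sigma>"
      using \<gamma> by (simp add: has_trace_def L2_fun_def)
    then have f\<gamma>: "(\<lambda>x. f (?\<gamma> x)) \<in> borel_measurable \<sigma>"
      by (rule measurable_compose[OF _ borel_measurable_continuous_onI[OF f_cont]])
    note green = green_identity[OF domain surface H2[OF t] \<gamma> traces[OF t] flux[OF t] f\<gamma>]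
    have J: "L2_inner ?M (u t) (weak_laplacian \<Omega> (u t)) = ?J - ?G"
      using green(2) by simp
    have utt: "L2_inner ?M (u t) (utt t) = ?J - ?G - b * A t"
      using L2_inner_wave_equation[OF \<Omega> L2(1)[OF t] L2(3)[OF t] green(1) wave[OF t]]
      unfolding J A_def .
    have growth: "?J \<ge> 2 * (1 + 2 * \<alpha>) * ?F - R0"
      unfolding R0
      by (rule boundary_growth[OF domain surface f_growth green(3) energy_eq[OF t, THEN conjunct1]])
    have "1/2 * (L2_norm ?M (ut t))\<^sup>2 + 1/2 * ?G + b/2 * A t - ?F = E0"
      using energy_eq[OF t] by (simp add: energy_def A_def)
    then have F: "2 * ?F = (L2_norm ?M (ut t))\<^sup>2 + ?G + b * A t - 2 * E0"
      by (simp add: field_simps)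
    have "(1 + 2 * \<alpha>) * (2 * ?F) - R0 = (1 + 2 * \<alpha>) * ((L2_norm ?M (ut t))\<^sup>2 + ?G + b * A t) - (1 + 2 * \<alpha>) * K"
      using \<alpha> unfolding F K_def by (simp add: field_simps)
    then have "2 * C t \<ge> 4 * (1 + \<alpha>) * (L2_norm ?M (ut t))\<^sup>2 + 4 * \<alpha> * (?G + b * A t) - 2 * (1 + 2 * \<alpha>) * K"
      using growth unfolding C_def utt by (simp add: algebra_simps)
    \<comment> \<open>This is where \<open>\<alpha> > 0\<close> absorbs the elastic energy, which entered with the wrong sign.\<close>
    moreover have "0 \<le> 4 * \<alpha> * (?G + b * A t)"
      using \<alpha> b by (simp add: A_def)
    ultimately show ?thesis
      by linarith
  qed

  have B0: "B 0 = L2_inner ?M u0 u1" and A0: "A 0 = (L2_norm ?M u0)\<^sup>2"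
    unfolding B_def A_def L2_norm_square
    using init L2[OF zero] by (auto intro!: L2_inner_cong_AE_lebesgue_on[OF \<Omega>] simp: L2_fun_def)
  have data': "(B 0)\<^sup>2 / A 0 > K" and K: "K > 0"
    using data data_pos by (simp_all add: B0 A0 K_def)
  have A0_pos: "A 0 > 0"
    using data' K by (cases "A 0 = 0") (auto simp: A_def less_le)

  interpret concavity_inequality T A "\<lambda>t. 2 * B t" "\<lambda>t. 2 * C t" \<alpha> K
  proof
    fix t assume t: "t \<in> ?I"
    show "(A has_real_derivative 2 * B t) (at t within ?I)"
      using has_derivative_L2_inner[OF du du cu t]
      unfolding A_def B_def L2_norm_square by (simp add: L2_inner_commute[of ?M "ut t" "u t"])
    show "((\<lambda>t. 2 * B t) has_real_derivative 2 * C t) (at t within ?I)"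
      using DERIV_cmult[OF has_derivative_L2_inner[OF du dut cut t], of 2]
      unfolding B_def C_def L2_norm_square .
    have "(B t)\<^sup>2 \<le> A t * (L2_norm ?M (ut t))\<^sup>2"
      unfolding A_def B_def by (rule L2_Cauchy_Schwarz_square[OF L2(1,2)[OF t]])
    then have "4 * (1 + \<alpha>) * (B t)\<^sup>2 \<le> 4 * (1 + \<alpha>) * (A t * (L2_norm ?M (ut t))\<^sup>2)"
      using \<alpha> by (intro mult_left_mono) auto
    moreover have "A t * (4 * (1 + \<alpha>) * (L2_norm ?M (ut t))\<^sup>2 - 2 * (1 + 2 * \<alpha>) * K) \<le> A t * (2 * C t)"
      by (intro mult_left_mono accel[OF t]) (simp add: A_def)
    ultimately show "A t * (2 * C t) - (1 + \<alpha>) * (2 * B t)\<^sup>2 \<ge> - 2 * (1 + 2 * \<alpha>) * K * A t"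
      by (simp add: algebra_simps power_mult_distrib)
  next
    show "(2 * B 0)\<^sup>2 > 4 * K * A 0"
      using data' A0_pos by (simp add: field_simps power_mult_distrib)
  qed (use T \<alpha> K A0_pos inner_pos B0 in auto)

  have "\<not> bdd_above (A ` ?I)"
  proof
    assume "bdd_above (A ` ?I)"
    then obtain c where c: "\<And>t. t \<in> ?I \<Longrightarrow> A t \<le> c"
      by (auto simp: bdd_above_def)
    have "bounded ((\<lambda>t. L2_norm ?M (u t)) ` ?I)"
      unfolding bounded_iff
    proof (intro exI ballI)
      fix x assume "x \<in> (\<lambda>t. L2_norm ?M (u t)) ` ?I"
      then obtain t where "t \<in> ?I" "x = L2_norm ?M (u t)"
        by blast
      then show "norm x \<le> sqrt c"
        using c[of t] by (simp add: A_def real_le_rsqrt)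
    qed
    then show False
      using continuation[OF finite_time] maximal by blast
  qed
  then have "filterlim A at_top (at_left (real_of_ereal T))"
    by (rule blow_up)
  then show ?thesis
    using finite_time unfolding A_def by blast
qed

end
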